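(* Let $\nu>0$ and $0<R'<\nu^{-1}$, and let $$O_-:=B_{R'}((0,0))\setminus\{(p,q)\in\mathbb{R}^2\mid q\ge|p|\}.$$ Let $D_0\supset O_-$ be an open set in $\mathbb{R}^2$ such that $D_0\subset B_R(z)$ for some $z\in\mathbb{R}^2$ and some $R<\nu^{-1}$. Let $\{D_t\}_{t\ge0}$ be the open evolution of $V=-\kappa+\nu$ with initial set $D_0$ and obstacles $O_-$ and $O_+=\mathbb{R}^2$, and let $\{E_t\}_{t\ge0}$ be the closed evolution of $V=-\kappa+\nu$ with initial set $E_0=\overline{D_0}$ and obstacles $C_-=\overline{O_-}$ and $C_+=\mathbb{R}^2$. Set $$A:=\bigcap\big\{\overline{B_{\nu^{-1}}(y)}\ \big|\ O_-\subset\overline{B_{\nu^{-1}}(y)},\ y\in\mathbb{R}^2\big\}$$ and let $A^{int}$ be its interior. Then $$A^{int}\subset\varliminf_{t\to\infty}D_t\subset\varlimsup_{t\to\infty}D_t\subset A$$ and $$A^{int}\subset\varliminf_{t\to\infty}E_t\subset\varlimsup_{t\to\infty}E_t\subset A.$$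
   Context: $B_r(z)$ is the open ball of radius $r$ centered at $z$. For a family of sets, $\varlimsup_{t\to\infty}D_t:=\bigcap_{\tau>0}\bigcup_{t>\tau}D_t$ and $\varliminf_{t\to\infty}D_t:=\bigcup_{\tau>0}\bigcap_{t>\tau}D_t$. Below $d=2$. Let $\mathbb{S}^d$ be the real symmetric $d\times d$ matrices, and $F(p,X)=-\mathrm{Tr}\big((I-\frac{p\otimes p}{|p|^2})X\big)$ for $p\in\mathbb{R}^d\setminus\{0\}$, $X\in\mathbb{S}^d$. Upper and lower stars denote upper and lower semicontinuous envelopes. For $\nu\in\mathbb{R}$, Lipschitz functions $\Psi_-\le\Psi_+$ on $\mathbb{R}^d$ and $u_0\in C(\mathbb{R}^d)$, consider the obstacle problem (P): $u_t-\nu|Du|+F(Du,D^2u)=0$ in $\mathbb{R}^d\times(0,\infty)$, $u(\cdot,0)=u_0$, $\Psi_-(x)\le u(x,t)\le\Psi_+(x)$ in $\mathbb{R}^d\times(0,\infty)$. $u$ is a viscosity subsolution of (P) if (a) $\Psi_-(x)\le u^*(x,t)\le\Psi_+(x)$ for all $(x,t)\in\mathbb{R}^d\times(0,\infty)$; (b) $u^*(x,0)\le u_0(x)$ for all $x$; (c) whenever $\phi$ is smooth, $u^*-\phi$ has a local maximum at $(x_0,t_0)\in\mathbb{R}^d\times(0,\infty)$ and $u^*(x_0,t_0)>\Psi_-(x_0)$, one has $\phi_t-\nu|D\phi|+F_*(D\phi,D^2\phi)\le0$ at $(x_0,t_0)$. $u$ is a viscosity supersolution if (a) $\Psi_-(x)\le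 u_*(x,t)\le\Psi_+(x)$ for all $(x,t)\in\mathbb{R}^d\times(0,\infty)$; (b) $u_*(x,0)\ge u_0(x)$ for all $x$; (c) whenever $\phi$ is smooth, $u_*-\phi$ has a local minimum at $(x_0,t_0)\in\mathbb{R}^d\times(0,\infty)$ and $u_*(x_0,t_0)<\Psi_+(x_0)$, one has $\phi_t-\nu|D\phi|+F^*(D\phi,D^2\phi)\ge0$ at $(x_0,t_0)$. A viscosity solution is both. For a constant $a<0$ let $K_a(\mathbb{R}^d\times[0,\infty))$ be the set of $u\in C(\mathbb{R}^d\times[0,\infty))$ such that for all $T>0$ there is $R>0$ with $u=a$ on $\{|x|\ge R\}\times[0,T]$. Open evolution: for open sets $D_0,O_-,O_+$, a family of open sets $\{D_t\}_{t\ge0}$ is the open evolution of $V=-\kappa+\nu$ with initial set $D_0$ and obstacles $O_-,O_+$ ($O_-\subset D_t\subset O_+$) if there exist Lipschitz $\Psi_\pm$, $u_0\in C(\mathbb{R}^d)$ and a viscosity solution $u\in K_a(\mathbb{R}^d\times[0,\infty))$ of (P) such that $O_\pm=\{\Psi_\pm>0\}$ and $D_t=\{x\mid u(x,t)>0\}$ for all $t\ge0$. Closed evolution: for closed sets $E_0,C_-,C_+$, the family of closed sets $\{E_t\}_{t\ge0}$ is defined in the same way with $C_\pm=\{\Psi_\pm\ge0\}$ and $E_t=\{x\mid u(x,t)\ge0\}$ for all $t\ge0$. Open and closed evolutions exist and are unique (known result). *)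

theory Defs
  imports "HOL-Analysis.Analysis"
begin

text \<open>
  The envelopes of a function \<open>f\<close> whose domain is \<open>S\<close>; values of \<open>f\<close> outside \<open>S\<close> are ignored.
  They are evaluated at points of the closure of \<open>S\<close>, and are extended real valued because \<open>f\<close>
  need not be locally bounded.
\<close>

definition usc_envelope :: "'a::metric_space set \<Rightarrow> ('a \<Rightarrow> real) \<Rightarrow> 'a \<Rightarrow> ereal" where
  "usc_envelope S f z = (INF r\<in>{0<..}. SUP w\<in>S \<inter> ball z r. ereal (f w))"

definition lsc_envelope :: "'a::metric_space set \<Rightarrow> ('a \<Rightarrow> real) \<Rightarrow> 'a \<Rightarrow> ereal" where
  "lsc_envelope S f z = (SUP r\<in>{0<..}. INF w\<in>S \<inter> ball z r. ereal (f w))"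

text \<open>\<open>C\<^sup>k\<close> functions on an open set \<open>S\<close>, by recursion over directional derivatives.\<close>

primrec Ck_on :: "nat \<Rightarrow> 'a::real_normed_vector set \<Rightarrow> ('a \<Rightarrow> real) \<Rightarrow> bool" where
  "Ck_on 0 S f \<longleftrightarrow> continuous_on S f"
| "Ck_on (Suc k) S f \<longleftrightarrow>
     (\<forall>x\<in>S. f differentiable at x) \<and> (\<forall>v. Ck_on k S (\<lambda>x. frechet_derivative f (at x) v))"

definition smooth_on :: "'a::real_normed_vector set \<Rightarrow> ('a \<Rightarrow> real) \<Rightarrow> bool" where
  "smooth_on S f \<longleftrightarrow> (\<forall>k. Ck_on k S f)"

text \<open>A point of space-time is a pair \<open>(x, t)\<close>; \<open>D\<close> and \<open>D\<^sup>2\<close> act on the space variable only.\<close>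

definition time_deriv :: "((real^'n) \<times> real \<Rightarrow> real) \<Rightarrow> (real^'n) \<times> real \<Rightarrow> real" where
  "time_deriv \<phi> z = frechet_derivative \<phi> (at z) (0, 1)"

definition space_partial ::
    "'n \<Rightarrow> ((real^'n) \<times> real \<Rightarrow> real) \<Rightarrow> (real^'n) \<times> real \<Rightarrow> real" where
  "space_partial i \<phi> z = frechet_derivative \<phi> (at z) (axis i 1, 0)"

definition space_grad :: "((real^'n) \<times> real \<Rightarrow> real) \<Rightarrow> (real^'n) \<times> real \<Rightarrow> real^'n" where
  "space_grad \<phi> z = (\<chi> i. space_partial i \<phi> z)"

definition space_hessian :: "((real^'n) \<times> real \<Rightarrow> real) \<Rightarrow> (real^'n) \<times> real \<Rightarrow> real^'n^'n" where
  "space_hessian \<phi> z = (\<chi> i j. space_partial i (space_partial j \<phi>) z)"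

definition tensor_square :: "real^'n \<Rightarrow> real^'n^'n" where
  "tensor_square p = (\<chi> i j. p $ i * p $ j)"

definition curv_op :: "(real^'n) \<times> (real^'n^'n) \<Rightarrow> real" where
  "curv_op = (\<lambda>(p, X). - trace ((mat 1 - (1 / (norm p)\<^sup>2) *\<^sub>R tensor_square p) ** X))"

text \<open>
  The domain of the operator in \<open>\<real>\<^sup>d \<times> \<S>\<^sup>d\<close>: its envelopes at \<open>p = 0\<close> are limits over \<open>p \<noteq> 0\<close>, so the value that
  division by zero gives to \<open>curv_op (0, X)\<close> is never used.
\<close>

definition curv_dom :: "((real^'n) \<times> (real^'n^'n)) set" where
  "curv_dom = {(p, X). p \<noteq> 0 \<and> transpose X = X}"

definition viscosity_subsolution ::
    "real \<Rightarrow> (real^'n \<Rightarrow> real) \<Rightarrow> (real^'n \<Rightarrow> real) \<Rightarrow> (real^'n \<Rightarrow> real)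
      \<Rightarrow> ((real^'n) \<times> real \<Rightarrow> real) \<Rightarrow> bool" where
  "viscosity_subsolution \<nu> \<Psi>m \<Psi>p u0 u \<longleftrightarrow>
    (let us = usc_envelope (UNIV \<times> {0..}) u in
      (\<forall>x t. 0 < t \<longrightarrow> ereal (\<Psi>m x) \<le> us (x, t) \<and> us (x, t) \<le> ereal (\<Psi>p x)) \<and>
      (\<forall>x. us (x, 0) \<le> ereal (u0 x)) \<and>
      (\<forall>\<phi> x0 t0.
        smooth_on (UNIV \<times> {0<..}) \<phi> \<and> 0 < t0 \<and>
        (\<forall>\<^sub>F z in nhds (x0, t0). us z - ereal (\<phi> z) \<le> us (x0, t0) - ereal (\<phi> (x0, t0))) \<and>
        us (x0, t0) > ereal (\<Psi>m x0) \<longrightarrow>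
        ereal (time_deriv \<phi> (x0, t0) - \<nu> * norm (space_grad \<phi> (x0, t0)))
          + lsc_envelope curv_dom curv_op (space_grad \<phi> (x0, t0), space_hessian \<phi> (x0, t0)) \<le> 0))"

definition viscosity_supersolution ::
    "real \<Rightarrow> (real^'n \<Rightarrow> real) \<Rightarrow> (real^'n \<Rightarrow> real) \<Rightarrow> (real^'n \<Rightarrow> real)
      \<Rightarrow> ((real^'n) \<times> real \<Rightarrow> real) \<Rightarrow> bool" where
  "viscosity_supersolution \<nu> \<Psi>m \<Psi>p u0 u \<longleftrightarrow>
    (let us = lsc_envelope (UNIV \<times> {0..}) u in
      (\<forall>x t. 0 < t \<longrightarrow> ereal (\<Psi>m x) \<le> us (x, t) \<and> us (x, t) \<le> ereal (\<Psi>p x)) \<and>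
      (\<forall>x. us (x, 0) \<ge> ereal (u0 x)) \<and>
      (\<forall>\<phi> x0 t0.
        smooth_on (UNIV \<times> {0<..}) \<phi> \<and> 0 < t0 \<and>
        (\<forall>\<^sub>F z in nhds (x0, t0). us z - ereal (\<phi> z) \<ge> us (x0, t0) - ereal (\<phi> (x0, t0))) \<and>
        us (x0, t0) < ereal (\<Psi>p x0) \<longrightarrow>
        ereal (time_deriv \<phi> (x0, t0) - \<nu> * norm (space_grad \<phi> (x0, t0)))
          + usc_envelope curv_dom curv_op (space_grad \<phi> (x0, t0), space_hessian \<phi> (x0, t0)) \<ge> 0))"

definition viscosity_solution ::
    "real \<Rightarrow> (real^'n \<Rightarrow> real) \<Rightarrow> (real^'n \<Rightarrow> real) \<Rightarrow> (real^'n \<Rightarrow> real)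
      \<Rightarrow> ((real^'n) \<times> real \<Rightarrow> real) \<Rightarrow> bool" where
  "viscosity_solution \<nu> \<Psi>m \<Psi>p u0 u \<longleftrightarrow>
    viscosity_subsolution \<nu> \<Psi>m \<Psi>p u0 u \<and> viscosity_supersolution \<nu> \<Psi>m \<Psi>p u0 u"

definition K_class :: "real \<Rightarrow> ((real^'n) \<times> real \<Rightarrow> real) set" where
  "K_class a = {u. continuous_on (UNIV \<times> {0..}) u \<and>
     (\<forall>T>0. \<exists>R>0. \<forall>x t. R \<le> norm x \<and> 0 \<le> t \<and> t \<le> T \<longrightarrow> u (x, t) = a)}"

definition obstacle_data ::
    "(real^'n \<Rightarrow> real) \<Rightarrow> (real^'n \<Rightarrow> real) \<Rightarrow> (real^'n \<Rightarrow> real) \<Rightarrow> bool" where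
  "obstacle_data \<Psi>m \<Psi>p u0 \<longleftrightarrow>
    (\<exists>L. L-lipschitz_on UNIV \<Psi>m) \<and> (\<exists>L. L-lipschitz_on UNIV \<Psi>p) \<and>
    (\<forall>x. \<Psi>m x \<le> \<Psi>p x) \<and> continuous_on UNIV u0"

text \<open>
  A family \<open>D\<close> of sets is indexed by \<open>real\<close>, but only its members at times \<open>t \<ge> 0\<close> matter.
\<close>

definition open_evolution ::
    "real \<Rightarrow> (real^'n) set \<Rightarrow> (real^'n) set \<Rightarrow> (real^'n) set \<Rightarrow> (real \<Rightarrow> (real^'n) set) \<Rightarrow> bool" where
  "open_evolution \<nu> D0 Om Op D \<longleftrightarrow>
    open D0 \<and> open Om \<and> open Op \<and> D 0 = D0 \<and>
    (\<forall>t\<ge>0. open (D t) \<and> Om \<subseteq> D t \<and> D t \<subseteq> Op) \<and>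
    (\<exists>a \<Psi>m \<Psi>p u0 u. a < 0 \<and> obstacle_data \<Psi>m \<Psi>p u0 \<and>
      viscosity_solution \<nu> \<Psi>m \<Psi>p u0 u \<and> u \<in> K_class a \<and>
      Om = {x. \<Psi>m x > 0} \<and> Op = {x. \<Psi>p x > 0} \<and>
      (\<forall>t\<ge>0. D t = {x. u (x, t) > 0}))"

definition closed_evolution ::
    "real \<Rightarrow> (real^'n) set \<Rightarrow> (real^'n) set \<Rightarrow> (real^'n) set \<Rightarrow> (real \<Rightarrow> (real^'n) set) \<Rightarrow> bool" where
  "closed_evolution \<nu> E0 Cm Cp E \<longleftrightarrow>
    closed E0 \<and> closed Cm \<and> closed Cp \<and> E 0 = E0 \<and>
    (\<forall>t\<ge>0. closed (E t) \<and> Cm \<subseteq> E t \<and> E t \<subseteq> Cp) \<and>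
    (\<exists>a \<Psi>m \<Psi>p u0 u. a < 0 \<and> obstacle_data \<Psi>m \<Psi>p u0 \<and>
      viscosity_solution \<nu> \<Psi>m \<Psi>p u0 u \<and> u \<in> K_class a \<and>
      Cm = {x. \<Psi>m x \<ge> 0} \<and> Cp = {x. \<Psi>p x \<ge> 0} \<and>
      (\<forall>t\<ge>0. E t = {x. u (x, t) \<ge> 0}))"

definition limsup_sets :: "(real \<Rightarrow> 'a set) \<Rightarrow> 'a set" where
  "limsup_sets D = (\<Inter>\<tau>\<in>{0<..}. \<Union>t\<in>{\<tau><..}. D t)"

definition liminf_sets :: "(real \<Rightarrow> 'a set) \<Rightarrow> 'a set" where
  "liminf_sets D = (\<Union>\<tau>\<in>{0<..}. \<Inter>t\<in>{\<tau><..}. D t)"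

definition notched_ball :: "real \<Rightarrow> (real^2) set" where
  "notched_ball r = ball 0 r - {x. x $ 2 \<ge> \<bar>x $ 1\<bar>}"

definition ball_hull :: "real \<Rightarrow> 'a::metric_space set \<Rightarrow> 'a set" where
  "ball_hull r S = \<Inter>{cball y r | y. S \<subseteq> cball y r}"

end

theory Submission
  imports Defs
begin

text \<open>
  Write \<open>m = 1/\<nu>\<close>. A circle of radius \<open>\<rho>\<close> moves under \<open>V = -\<kappa> + \<nu>\<close> with outward speed
  \<open>\<nu> - 1/\<rho>\<close>: it shrinks if \<open>\<rho> < m\<close> and grows if \<open>\<rho> > m\<close>. Hence a family of discs that moves slowly
  enough is a strict supersolution as long as all radii stay below \<open>m\<close>, and a strict subsolution as
  long as they stay above \<open>m\<close>. Both halves of the theorem follow by trapping the evolution with such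
  families, and only explicit barriers are compared with the solution.

  The families are pencils of circles. For \<open>\<psi>\<^sub>i(x) = P\<^sub>i - |x - z\<^sub>i|\<^sup>2\<close> the convex combination
  \<open>\<psi> = (1-s)\<psi>\<^sub>0 + s\<psi>\<^sub>1\<close> is again of this form, and it is affine in the parameter \<open>s\<close>. So whatever is
  inside (or outside) the first and the last disc is inside (or outside) every intermediate one, and
  with \<open>s = 1 - exp (-\<epsilon> t)\<close> the family drifts from the first disc towards the last one as slowly as
  one likes. The test functions are
  \<open>c \<plusminus> (\<delta> exp (\<plusminus>k \<psi>) + \<delta> exp (N (t - T)))\<close>. Where \<open>\<psi>\<close> is near \<open>0\<close> the viscosity inequality at a
  touching point contradicts the strict motion of the circles. Where \<open>\<psi>\<close> has the sign that makes
  \<open>k exp (\<plusminus>k \<psi>)\<close> small, the increasing last term beats it for large \<open>k\<close>. Where \<open>\<psi>\<close> has the other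
  sign, large \<open>k\<close> puts the barrier beyond the bounds of the solution, so that it can start there and
  take its lateral values there. The last term also pushes the touching point away from the final
  time. This gives \<open>upper_bound_outside_disc\<close> and \<open>lower_bound_inside_disc\<close>.

  Upper bound. If \<open>x\<close> is not in the hull \<open>A\<close>, some disc of radius \<open>m\<close> about \<open>y\<close> contains the obstacle
  but not \<open>x\<close>. Drift from a disc of radius less than \<open>m\<close> containing the initial set to a member of the
  pencil that is close enough to the disc about \<open>y\<close> to exclude \<open>x\<close> (\<open>exists_disc_between\<close>). Every
  member contains the obstacle and has radius less than \<open>m\<close>. For the closed evolution one first
  enlarges the initial disc, so that the obstacle lies strictly inside and the solution is bounded
  by a negative constant outside.

  Lower bound. Testing the hull against suitable discs of radius \<open>m\<close> shows that a point of its interior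
  outside the obstacle lies in the notch, below the arc of radius \<open>m\<close> through the two corners of the
  notch. Discs of radius greater than \<open>m\<close> that drift upwards through the apex of the notch until they
  contain the point fill the notch (\<open>notch_filling_discs\<close>). The comparison takes place in a sector around
  the notch: its sides lie in the obstacle, and its circular edge stays outside the discs.
\<close>

section \<open>Smooth functions\<close>

text \<open>
  Test functions have to be \<open>C\<^sup>k\<close> for every \<open>k\<close>. The barriers are built from coordinates by sums, products
  and exponentials, so closure under these operations on the whole space is enough. Working on \<^term>\<open>UNIV\<close>
  makes equal derivatives equal functions, and restriction to an open set comes at the end.
\<close>

lemma Ck_on_mono: "Ck_on k S f \<Longrightarrow> T \<subseteq> S \<Longrightarrow> Ck_on k T f"
  by (induction k arbitrary: f) (auto intro: continuous_on_subset)

lemma Ck_on_SucD: "Ck_on (Suc k) S f \<Longrightarrow> Ck_on k S f"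
proof (induction k arbitrary: f)
  case 0
  then show ?case
    by (auto intro!: differentiable_imp_continuous_on differentiable_at_imp_differentiable_on)
qed auto

lemma Ck_on_const: "Ck_on k UNIV (\<lambda>x. c)"
proof (induction k arbitrary: c)
  case (Suc k)
  have "frechet_derivative (\<lambda>x::'a. c) (at x) v = 0" for x v by simp
  then show ?case using Suc[of 0] by simp
qed simp

lemma Ck_on_bounded_linear:
  assumes "bounded_linear f" shows "Ck_on k UNIV f"
proof (cases k)
  case 0
  then show ?thesis using assms by (simp add: linear_continuous_on)
next
  case (Suc n)
  have "frechet_derivative f (at x) = f" for x
    using frechet_derivative_at[OF bounded_linear_imp_has_derivative[OF assms]] by simp
  then show ?thesis
    using Suc assms by (simp add: Ck_on_const bounded_linear_imp_differentiable)
qed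

lemma Ck_on_add:
  "Ck_on k UNIV f \<Longrightarrow> Ck_on k UNIV g \<Longrightarrow> Ck_on k UNIV (\<lambda>x. f x + g x)"
proof (induction k arbitrary: f g)
  case (Suc k)
  have "frechet_derivative (\<lambda>x. f x + g x) (at x) v
      = frechet_derivative f (at x) v + frechet_derivative g (at x) v" for x v
  proof -
    have "(f has_derivative frechet_derivative f (at x)) (at x)"
      using Suc.prems frechet_derivative_works by (metis Ck_on.simps(2) UNIV_I)
    moreover have "(g has_derivative frechet_derivative g (at x)) (at x)"
      using Suc.prems frechet_derivative_works by (metis Ck_on.simps(2) UNIV_I)
    ultimately show ?thesis
      using frechet_derivative_at[OF has_derivative_add] by metis
  qed
  then show ?case using Suc by (simp add: differentiable_add)
qed (simp add: continuous_on_add)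

lemma Ck_on_mult:
  "Ck_on k UNIV f \<Longrightarrow> Ck_on k UNIV g \<Longrightarrow> Ck_on k UNIV (\<lambda>x. f x * g x)"
proof (induction k arbitrary: f g)
  case (Suc k)
  have D: "frechet_derivative (\<lambda>x. f x * g x) (at x) v
      = f x * frechet_derivative g (at x) v + frechet_derivative f (at x) v * g x" for x v
  proof -
    have f: "(f has_derivative frechet_derivative f (at x)) (at x)"
      using Suc.prems frechet_derivative_works by (metis Ck_on.simps(2) UNIV_I)
    have g: "(g has_derivative frechet_derivative g (at x)) (at x)"
      using Suc.prems frechet_derivative_works by (metis Ck_on.simps(2) UNIV_I)
    from has_derivative_mult[OF f g] show ?thesis
      by (subst frechet_derivative_at[symmetric]) (auto simp: fun_eq_iff)
  qed
  have "Ck_on k UNIV f" "Ck_on k UNIV g" using Suc.prems Ck_on_SucD by blast+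
  then show ?case using Suc by (simp add: D differentiable_mult Ck_on_add)
qed (simp add: continuous_on_mult)

lemma Ck_on_diff:
  assumes "Ck_on k UNIV f" "Ck_on k UNIV g" shows "Ck_on k UNIV (\<lambda>x. f x - g x)"
  using Ck_on_add[OF assms(1) Ck_on_mult[OF Ck_on_const[of k "- 1"] assms(2)]] by simp

lemma Ck_on_exp: "Ck_on k UNIV f \<Longrightarrow> Ck_on k UNIV (\<lambda>x. exp (f x))"
proof (induction k arbitrary: f)
  case 0
  then show ?case by (simp add: continuous_on_exp)
next
  case (Suc k)
  have fd: "(f has_derivative frechet_derivative f (at x)) (at x)" for x
    using Suc.prems frechet_derivative_works by auto
  have hd: "((\<lambda>x. exp (f x)) has_derivative
      (\<lambda>v. exp (f x) * frechet_derivative f (at x) v)) (at x)" for x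
    using fd by (auto intro!: derivative_eq_intros)
  have D: "frechet_derivative (\<lambda>x. exp (f x)) (at x) v
      = exp (f x) * frechet_derivative f (at x) v" for x v
    by (subst frechet_derivative_at[OF hd, symmetric]) simp
  have "Ck_on k UNIV f" using Suc.prems Ck_on_SucD by blast
  then show ?case
    using Suc hd by (auto simp: D differentiable_def intro!: Ck_on_mult)
qed

section \<open>Viscosity inequalities of continuous solutions\<close>

text \<open>
  Members of \<^const>\<open>K_class\<close> are continuous up to time \<open>0\<close>, so both envelopes in the definition of a
  solution agree with the solution, and the viscosity inequalities become statements about \<open>u\<close> itself.
\<close>

lemma usc_envelope_eq:
  assumes "continuous_on S f" "z \<in> S"
  shows "usc_envelope S f z = ereal (f z)"
proof (rule antisym)
  show "usc_envelope S f z \<le> ereal (f z)"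
  proof (rule ereal_le_epsilon2)
    fix e :: real assume "0 < e"
    then obtain r where r: "r > 0" "\<And>w. w \<in> S \<Longrightarrow> dist w z < r \<Longrightarrow> dist (f w) (f z) < e"
      using assms unfolding continuous_on_iff by metis
    have "(SUP w\<in>S \<inter> ball z r. ereal (f w)) \<le> ereal (f z) + ereal e"
    proof (rule SUP_least)
      fix w assume "w \<in> S \<inter> ball z r"
      then have "dist (f w) (f z) < e" using r(2)[of w] by (simp add: dist_commute)
      then show "ereal (f w) \<le> ereal (f z) + ereal e" by (simp add: dist_real_def)
    qed
    then show "usc_envelope S f z \<le> ereal (f z) + ereal e"
      unfolding usc_envelope_def using r(1) by (meson INF_lower2 greaterThan_iff)
  qed
  show "ereal (f z) \<le> usc_envelope S f z"
    unfolding usc_envelope_def using assms(2) by (auto intro!: INF_greatest SUP_upper)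
qed

lemma lsc_envelope_eq:
  assumes "continuous_on S f" "z \<in> S"
  shows "lsc_envelope S f z = ereal (f z)"
proof (rule antisym)
  show "ereal (f z) \<le> lsc_envelope S f z"
  proof (rule ereal_le_epsilon2)
    fix e :: real assume "0 < e"
    then obtain r where r: "r > 0" "\<And>w. w \<in> S \<Longrightarrow> dist w z < r \<Longrightarrow> dist (f w) (f z) < e"
      using assms unfolding continuous_on_iff by metis
    have "ereal (f z - e) \<le> (INF w\<in>S \<inter> ball z r. ereal (f w))"
    proof (rule INF_greatest)
      fix w assume "w \<in> S \<inter> ball z r"
      then have "dist (f w) (f z) < e" using r(2)[of w] by (simp add: dist_commute)
      then show "ereal (f z - e) \<le> ereal (f w)" by (simp add: dist_real_def)
    qed
    then have "ereal (f z - e) \<le> lsc_envelope S f z"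
      unfolding lsc_envelope_def using r(1) by (meson SUP_upper2 greaterThan_iff)
    then have "ereal (f z - e) + ereal e \<le> lsc_envelope S f z + ereal e"
      by (rule add_right_mono)
    then show "ereal (f z) \<le> lsc_envelope S f z + ereal e" by simp
  qed
  show "lsc_envelope S f z \<le> ereal (f z)"
    unfolding lsc_envelope_def using assms(2) by (auto intro!: SUP_least INF_lower)
qed

text \<open>
  The envelopes are known to equal \<open>u\<close> only at nonnegative times, whereas touching is required on a full
  neighbourhood in space-time.
\<close>

lemma eventually_nhds_pos_time:
  fixes x0 :: "'a::metric_space"
  assumes "0 < (t0::real)" shows "\<forall>\<^sub>F z in nhds (x0, t0). z \<in> UNIV \<times> {0..}"
proof -
  have "open (UNIV \<times> {0<..} :: ('a \<times> real) set)" by (intro open_Times) auto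
  then have "\<forall>\<^sub>F z in nhds (x0, t0). z \<in> UNIV \<times> {0<..}"
    using assms by (intro eventually_nhds_in_open) auto
  then show ?thesis by eventually_elim auto
qed

lemma subsolution_touch:
  assumes "viscosity_subsolution \<nu> \<Psi>m \<Psi>p u0 u" and cont: "continuous_on (UNIV \<times> {0..}) u"
    and "smooth_on (UNIV \<times> {0<..}) \<phi>" "0 < t0"
    and ev: "\<forall>\<^sub>F z in nhds (x0, t0). u z - \<phi> z \<le> u (x0, t0) - \<phi> (x0, t0)"
    and "\<Psi>m x0 < u (x0, t0)"
  shows "ereal (time_deriv \<phi> (x0, t0) - \<nu> * norm (space_grad \<phi> (x0, t0)))
          + lsc_envelope curv_dom curv_op (space_grad \<phi> (x0, t0), space_hessian \<phi> (x0, t0)) \<le> 0"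
proof -
  note us = usc_envelope_eq[OF cont]
  have "\<forall>\<^sub>F z in nhds (x0, t0). usc_envelope (UNIV \<times> {0..}) u z - ereal (\<phi> z)
      \<le> usc_envelope (UNIV \<times> {0..}) u (x0, t0) - ereal (\<phi> (x0, t0))"
    using ev eventually_nhds_pos_time[OF \<open>0 < t0\<close>, of x0]
    by eventually_elim (use \<open>0 < t0\<close> in \<open>auto simp: us\<close>)
  then show ?thesis
    using assms us[of "(x0, t0)"] unfolding viscosity_subsolution_def Let_def by auto
qed

lemma supersolution_touch:
  assumes "viscosity_supersolution \<nu> \<Psi>m \<Psi>p u0 u" and cont: "continuous_on (UNIV \<times> {0..}) u"
    and "smooth_on (UNIV \<times> {0<..}) \<phi>" "0 < t0"
    and ev: "\<forall>\<^sub>F z in nhds (x0, t0). u z - \<phi> z \<ge> u (x0, t0) - \<phi> (x0, t0)"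
    and "u (x0, t0) < \<Psi>p x0"
  shows "ereal (time_deriv \<phi> (x0, t0) - \<nu> * norm (space_grad \<phi> (x0, t0)))
          + usc_envelope curv_dom curv_op (space_grad \<phi> (x0, t0), space_hessian \<phi> (x0, t0)) \<ge> 0"
proof -
  note us = lsc_envelope_eq[OF cont]
  have "\<forall>\<^sub>F z in nhds (x0, t0). lsc_envelope (UNIV \<times> {0..}) u z - ereal (\<phi> z)
      \<ge> lsc_envelope (UNIV \<times> {0..}) u (x0, t0) - ereal (\<phi> (x0, t0))"
    using ev eventually_nhds_pos_time[OF \<open>0 < t0\<close>, of x0]
    by eventually_elim (use \<open>0 < t0\<close> in \<open>auto simp: us\<close>)
  then show ?thesis
    using assms us[of "(x0, t0)"] unfolding viscosity_supersolution_def Let_def by auto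
qed

text \<open>
  The definition imposes the obstacle condition at positive times; continuity extends it to time \<open>0\<close>.
\<close>

lemma solution_obstacle:
  assumes "viscosity_solution \<nu> \<Psi>m \<Psi>p u0 u" "continuous_on (UNIV \<times> {0..}) u" "0 \<le> t"
  shows "\<Psi>m x \<le> u (x, t)"
proof -
  have pos: "\<Psi>m x \<le> u (x, t)" if "0 < t" for t
  proof -
    have "ereal (\<Psi>m x) \<le> usc_envelope (UNIV \<times> {0..}) u (x, t)"
    proof -
      have "viscosity_subsolution \<nu> \<Psi>m \<Psi>p u0 u"
        using assms(1) by (simp add: viscosity_solution_def)
      then have "\<forall>x t. 0 < t \<longrightarrow> ereal (\<Psi>m x) \<le> usc_envelope (UNIV \<times> {0..}) u (x, t)
          \<and> usc_envelope (UNIV \<times> {0..}) u (x, t) \<le> ereal (\<Psi>p x)"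
        unfolding viscosity_subsolution_def Let_def by (rule conjunct1)
      then show ?thesis using that by simp
    qed
    then show ?thesis using usc_envelope_eq[OF assms(2), of "(x, t)"] that by simp
  qed
  have "continuous_on {0..} (\<lambda>t. u (x, t))"
    by (rule continuous_on_compose2[OF assms(2)]) (auto intro!: continuous_intros)
  show ?thesis
  proof (cases "0 < t")
    case False
    then have "t = 0" using assms(3) by simp
    have "((\<lambda>t. u (x, t)) \<longlongrightarrow> u (x, 0)) (at 0 within {0..})"
      using \<open>continuous_on {0..} (\<lambda>t. u (x, t))\<close> by (simp add: continuous_on_def)
    then have "((\<lambda>t. u (x, t)) \<longlongrightarrow> u (x, 0)) (at_right 0)"
      by (rule tendsto_within_subset) auto
    then show ?thesis
      unfolding \<open>t = 0\<close>
      by (rule tendsto_lowerbound) (auto intro!: eventually_mono[OF eventually_at_right_less] pos)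
  qed (use pos in auto)
qed

section \<open>Envelopes of the curvature operator in the plane\<close>

text \<open>
  In the plane \<open>I - n \<otimes> n\<close> has rank one, so it sends \<open>\<alpha> I\<close> to trace \<open>\<alpha>\<close> and \<open>p \<otimes> p\<close> to
  \<open>|p|\<^sup>2 - (n \<cdot> p)\<^sup>2\<close>. For \<open>n = q/|q|\<close> this is the squared distance of \<open>p\<close> from the line through \<open>q\<close>, hence at
  most \<open>|p - q|\<^sup>2\<close>. The estimate is uniform as \<open>p\<close> tends to \<open>0\<close>, so it also covers touching at the
  centre of the circles, where the gradient of the barrier vanishes.
\<close>

lemma curv_op_2:
  fixes p q :: "real^2" and Y :: "real^2^2" and \<alpha> \<beta> :: real
  assumes "q \<noteq> 0"
  defines "X \<equiv> \<alpha> *\<^sub>R mat 1 + \<beta> *\<^sub>R tensor_square p"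
  shows "\<bar>curv_op (q, Y) + \<alpha>\<bar> \<le> 8 * norm (Y - X) + \<bar>\<beta>\<bar> * (norm (p - q))\<^sup>2"
proof -
  define n where "n = (1 / norm q) *\<^sub>R q"
  define Z where "Z = Y - X"
  have qn: "q = norm q *\<^sub>R n" using assms by (simp add: n_def)
  have nn: "(n $ 1)\<^sup>2 + (n $ 2)\<^sup>2 = 1"
  proof -
    have "norm n = 1" using assms by (simp add: n_def)
    then have "n \<bullet> n = 1" by (simp add: norm_eq_1)
    then show ?thesis by (simp add: inner_vec_def sum_2 power2_eq_square)
  qed
  have T: "(1 / (norm q)\<^sup>2) *\<^sub>R tensor_square q = tensor_square n"
    by (simp add: tensor_square_def n_def vec_eq_iff power2_eq_square)
  have Yx: "Y $ i $ j = Z $ i $ j + \<alpha> * (if i = j then 1 else 0) + \<beta> * p $ i * p $ j" for i j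
    by (simp add: Z_def X_def mat_def tensor_square_def)
  define G where "G = (p $ 1)\<^sup>2 + (p $ 2)\<^sup>2 - (n $ 1 * p $ 1 + n $ 2 * p $ 2)\<^sup>2"
  define H where "H = (1 - (n$1)\<^sup>2) * Z$1$1 - n$1 * n$2 * Z$2$1 - n$2 * n$1 * Z$1$2 + (1 - (n$2)\<^sup>2) * Z$2$2"
  have "curv_op (q, Y) = - ((1 - (n$1)\<^sup>2) * Y$1$1 - n$1 * n$2 * Y$2$1 - n$2 * n$1 * Y$1$2 + (1 - (n$2)\<^sup>2) * Y$2$2)"
    unfolding curv_op_def prod.case T using assms(1)
    by (simp add: trace_def matrix_matrix_mult_def sum_2 mat_def tensor_square_def
        power2_eq_square algebra_simps)
  also have "\<dots> = - H - \<alpha> * (2 - ((n$1)\<^sup>2 + (n$2)\<^sup>2)) - \<beta> * G"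
    by (simp add: Yx H_def G_def power2_eq_square algebra_simps)
  finally have main: "curv_op (q, Y) + \<alpha> = - H - \<beta> * G" using nn by simp
  have G: "0 \<le> G" "G \<le> (norm (p - q))\<^sup>2"
  proof -
    have "G = ((p $ 1)\<^sup>2 + (p $ 2)\<^sup>2) * ((n $ 1)\<^sup>2 + (n $ 2)\<^sup>2) - (n $ 1 * p $ 1 + n $ 2 * p $ 2)\<^sup>2"
      by (simp add: nn G_def)
    also have "\<dots> = (p $ 1 * n $ 2 - p $ 2 * n $ 1)\<^sup>2"
      by (simp add: power2_eq_square algebra_simps)
    finally show "0 \<le> G" by simp
    have "(norm (p - q))\<^sup>2 = (p $ 1 - norm q * n $ 1)\<^sup>2 + (p $ 2 - norm q * n $ 2)\<^sup>2"
    proof -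
      have "q $ i = norm q * n $ i" for i :: 2 using assms(1) by (simp add: n_def)
      then show ?thesis
        unfolding power2_norm_eq_inner inner_vec_def sum_2 by (simp add: power2_eq_square)
    qed
    also have "\<dots> = (p $ 1)\<^sup>2 + (p $ 2)\<^sup>2 - 2 * norm q * (n $ 1 * p $ 1 + n $ 2 * p $ 2)
        + (norm q)\<^sup>2 * ((n $ 1)\<^sup>2 + (n $ 2)\<^sup>2)"
      by (simp add: power2_eq_square algebra_simps)
    also have "\<dots> = G + (n $ 1 * p $ 1 + n $ 2 * p $ 2 - norm q)\<^sup>2"
      by (simp add: nn) (simp add: G_def power2_eq_square algebra_simps)
    finally show "G \<le> (norm (p - q))\<^sup>2" by simp
  qed
  have n1: "(n$1)\<^sup>2 \<le> 1" "(n$2)\<^sup>2 \<le> 1" using nn zero_le_power2[of "n$1"] zero_le_power2[of "n$2"] by linarith+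
  then have n2: "\<bar>n$1\<bar> \<le> 1" "\<bar>n$2\<bar> \<le> 1" by (simp_all add: abs_square_le_1)
  have Zb: "\<bar>Z$i$j\<bar> \<le> norm Z" for i j
    using component_le_norm_cart[of "Z$i" j] Finite_Cartesian_Product.norm_nth_le[of Z i] by linarith
  have bd: "\<bar>s * z\<bar> \<le> norm Z" if "\<bar>s\<bar> \<le> 1" "\<bar>z\<bar> \<le> norm Z" for s z :: real
    using mult_mono[OF that] by (simp add: abs_mult)
  have "\<bar>H\<bar> \<le> 8 * norm Z"
  proof -
    have "\<bar>(1 - (n$1)\<^sup>2) * Z$1$1\<bar> \<le> norm Z" "\<bar>(1 - (n$2)\<^sup>2) * Z$2$2\<bar> \<le> norm Z"
      using n1 by (auto intro!: bd Zb)
    moreover have "\<bar>(n$1 * n$2) * Z$2$1\<bar> \<le> norm Z" "\<bar>(n$2 * n$1) * Z$1$2\<bar> \<le> norm Z"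
      using n2 by (intro bd Zb; simp add: abs_mult mult_le_one)+
    moreover have "0 \<le> norm Z" by simp
    ultimately show ?thesis unfolding H_def by linarith
  qed
  moreover have "\<bar>\<beta> * G\<bar> \<le> \<bar>\<beta>\<bar> * (norm (p - q))\<^sup>2"
    using G by (simp add: abs_mult mult_left_mono)
  ultimately show ?thesis unfolding main Z_def by linarith
qed

lemma curv_envelopes:
  fixes p :: "real^2"
  shows "ereal (- \<alpha>) \<le> lsc_envelope curv_dom curv_op (p, \<alpha> *\<^sub>R mat 1 + \<beta> *\<^sub>R tensor_square p)"
    and "usc_envelope curv_dom curv_op (p, \<alpha> *\<^sub>R mat 1 + \<beta> *\<^sub>R tensor_square p) \<le> ereal (- \<alpha>)"
proof -
  define X where "X = \<alpha> *\<^sub>R mat 1 + \<beta> *\<^sub>R tensor_square p"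
  have near: "\<exists>r>0. \<forall>w \<in> curv_dom \<inter> ball (p, X) r. \<bar>curv_op w + \<alpha>\<bar> \<le> e" if "e > 0" for e
  proof -
    define r where "r = min 1 (e / (8 + \<bar>\<beta>\<bar>))"
    have r: "0 < r" "r \<le> 1" "(8 + \<bar>\<beta>\<bar>) * r \<le> e"
    proof -
      have "r \<le> e / (8 + \<bar>\<beta>\<bar>)" by (simp add: r_def)
      then show "(8 + \<bar>\<beta>\<bar>) * r \<le> e" by (simp add: field_simps)
    qed (use that in \<open>auto simp: r_def intro!: divide_pos_pos\<close>)
    have "\<bar>curv_op w + \<alpha>\<bar> \<le> e" if "w \<in> curv_dom \<inter> ball (p, X) r" for w
    proof -
      obtain q Y where w: "w = (q, Y)" by (cases w)
      have q: "q \<noteq> 0" using that by (auto simp: w curv_dom_def)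
      have d: "norm (p - q) < r" "norm (Y - X) < r"
        using that dist_fst_le[of "(p, X)" w] dist_snd_le[of "(p, X)" w]
        by (auto simp: w dist_norm norm_minus_commute)
      have "(norm (p - q))\<^sup>2 \<le> r"
      proof -
        have "(norm (p - q))\<^sup>2 \<le> r\<^sup>2" using d by (intro power_mono) auto
        also have "\<dots> \<le> r" using r by (simp add: power2_eq_square mult_left_le)
        finally show ?thesis .
      qed
      then have "\<bar>\<beta>\<bar> * (norm (p - q))\<^sup>2 \<le> \<bar>\<beta>\<bar> * r" by (intro mult_left_mono) auto
      then show ?thesis
        using curv_op_2[OF q, of Y \<alpha> \<beta> p] d r(3) unfolding w X_def[symmetric]
        by (simp add: algebra_simps)
    qed
    then show ?thesis using r by blast
  qed
  show "ereal (- \<alpha>) \<le> lsc_envelope curv_dom curv_op (p, \<alpha> *\<^sub>R mat 1 + \<beta> *\<^sub>R tensor_square p)"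
    unfolding X_def[symmetric]
  proof (rule ereal_le_epsilon2)
    fix e :: real assume "0 < e"
    obtain r where r: "0 < r" "\<And>w. w \<in> curv_dom \<inter> ball (p, X) r \<Longrightarrow> \<bar>curv_op w + \<alpha>\<bar> \<le> e"
      using near[OF \<open>0 < e\<close>] by blast
    have "ereal (- \<alpha> - e) \<le> (INF w\<in>curv_dom \<inter> ball (p, X) r. ereal (curv_op w))"
      by (rule INF_greatest) (use r(2) in fastforce)
    then have "ereal (- \<alpha> - e) \<le> lsc_envelope curv_dom curv_op (p, X)"
      unfolding lsc_envelope_def using r(1) by (meson SUP_upper2 greaterThan_iff)
    then have "ereal (- \<alpha> - e) + ereal e \<le> lsc_envelope curv_dom curv_op (p, X) + ereal e"
      by (rule add_right_mono)
    then show "ereal (- \<alpha>) \<le> lsc_envelope curv_dom curv_op (p, X) + ereal e" by simp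
  qed
  show "usc_envelope curv_dom curv_op (p, \<alpha> *\<^sub>R mat 1 + \<beta> *\<^sub>R tensor_square p) \<le> ereal (- \<alpha>)"
    unfolding X_def[symmetric]
  proof (rule ereal_le_epsilon2)
    fix e :: real assume "0 < e"
    obtain r where r: "0 < r" "\<And>w. w \<in> curv_dom \<inter> ball (p, X) r \<Longrightarrow> \<bar>curv_op w + \<alpha>\<bar> \<le> e"
      using near[OF \<open>0 < e\<close>] by blast
    have "(SUP w\<in>curv_dom \<inter> ball (p, X) r. ereal (curv_op w)) \<le> ereal (- \<alpha>) + ereal e"
      by (rule SUP_least) (use r(2) in fastforce)
    then show "usc_envelope curv_dom curv_op (p, X) \<le> ereal (- \<alpha>) + ereal e"
      unfolding usc_envelope_def using r(1) by (meson INF_lower2 greaterThan_iff)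
  qed
qed

section \<open>Interior touching points\<close>

text \<open>
  A maximum of \<open>u - \<phi>\<close> over a space-time cylinder is a local maximum on a full neighbourhood once \<open>\<phi>\<close> is
  strictly above \<open>u\<close> on the whole boundary. The boundary includes the final time, because touching from
  one side of the final time only would not be admissible in the definition of a solution.
\<close>

lemma interior_touch:
  fixes u \<phi> :: "'a::metric_space \<times> real \<Rightarrow> real"
  assumes "compact \<Omega>" "continuous_on (\<Omega> \<times> {0..T}) u" "continuous_on (\<Omega> \<times> {0..T}) \<phi>"
    and "x1 \<in> \<Omega>" "0 \<le> t1" "t1 \<le> T" "\<phi> (x1, t1) < u (x1, t1)"
    and bottom: "\<And>x. x \<in> \<Omega> \<Longrightarrow> u (x, 0) < \<phi> (x, 0)"
    and top: "\<And>x. x \<in> \<Omega> \<Longrightarrow> u (x, T) < \<phi> (x, T)"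
    and side: "\<And>x t. x \<in> \<Omega> \<Longrightarrow> x \<notin> interior \<Omega> \<Longrightarrow> 0 \<le> t \<Longrightarrow> t \<le> T \<Longrightarrow> u (x, t) < \<phi> (x, t)"
  obtains x0 t0 where "x0 \<in> interior \<Omega>" "0 < t0" "t0 < T" "\<phi> (x0, t0) < u (x0, t0)"
    "\<forall>\<^sub>F z in nhds (x0, t0). u z - \<phi> z \<le> u (x0, t0) - \<phi> (x0, t0)"
proof -
  have "compact (\<Omega> \<times> {0..T})" "\<Omega> \<times> {0..T} \<noteq> {}"
    using assms by (auto intro: compact_Times)
  moreover have "continuous_on (\<Omega> \<times> {0..T}) (\<lambda>z. u z - \<phi> z)"
    using assms by (intro continuous_on_diff)
  ultimately obtain z0 where z0: "z0 \<in> \<Omega> \<times> {0..T}"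
      "\<And>z. z \<in> \<Omega> \<times> {0..T} \<Longrightarrow> u z - \<phi> z \<le> u z0 - \<phi> z0"
    using continuous_attains_sup[of "\<Omega> \<times> {0..T}" "\<lambda>z. u z - \<phi> z"] by auto
  obtain x0 t0 where zz: "z0 = (x0, t0)" by (cases z0)
  have pos: "\<phi> (x0, t0) < u (x0, t0)" using z0(2)[of "(x1, t1)"] assms zz by auto
  have in0: "x0 \<in> \<Omega>" "0 \<le> t0" "t0 \<le> T" using z0 zz by auto
  have i: "x0 \<in> interior \<Omega>" using side[of x0 t0] in0 pos by force
  have t: "0 < t0" "t0 < T" using bottom[of x0] top[of x0] in0 pos by (force simp: order_less_le)+
  have "open (interior \<Omega> \<times> {0<..<T})" by (intro open_Times) auto
  then have "\<forall>\<^sub>F z in nhds (x0, t0). z \<in> interior \<Omega> \<times> {0<..<T}"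
    using i t by (intro eventually_nhds_in_open) auto
  then have "\<forall>\<^sub>F z in nhds (x0, t0). u z - \<phi> z \<le> u (x0, t0) - \<phi> (x0, t0)"
    by eventually_elim (use z0(2) zz interior_subset in force)
  then show ?thesis using that i t pos by blast
qed

lemma compact_uniformly_pos:
  fixes f :: "'a::metric_space \<Rightarrow> real"
  assumes "compact S" "continuous_on S f" "\<And>x. x \<in> S \<Longrightarrow> 0 < f x"
  obtains \<eta> where "0 < \<eta>" "\<And>x. x \<in> S \<Longrightarrow> \<eta> \<le> f x"
proof (cases "S = {}")
  case True
  then show ?thesis using that[of 1] by simp
next
  case False
  then obtain x where "x \<in> S" "\<And>y. y \<in> S \<Longrightarrow> f x \<le> f y"
    using continuous_attains_inf[OF assms(1) _ assms(2)] by blast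
  then show ?thesis using that[of "f x"] assms(3) by blast
qed

lemma compact_abs_bound:
  fixes f :: "'a::metric_space \<Rightarrow> real"
  assumes "compact S" "continuous_on S f"
  obtains B where "0 < B" "\<And>x. x \<in> S \<Longrightarrow> \<bar>f x\<bar> \<le> B"
proof -
  have "bounded (f ` S)" using assms compact_continuous_image compact_imp_bounded by blast
  then show ?thesis using that unfolding bounded_pos by auto
qed

text \<open>
  This makes the gradient terms of a barrier negligible on the side where its exponential decays.
\<close>

lemma mult_exp_small:
  fixes \<eta> e :: real
  assumes "0 < \<eta>" "0 < e"
  shows "\<forall>\<^sub>F k in at_top. k * exp (- (k * \<eta>)) < e"
proof -
  have "((\<lambda>k. (\<eta> * k) ^ 1 / exp (\<eta> * k)) \<longlongrightarrow> 0) at_top"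
    by (rule filterlim_compose[OF tendsto_power_div_exp_0])
       (use assms in \<open>auto intro!: filterlim_tendsto_pos_mult_at_top[of _ \<eta>] filterlim_ident\<close>)
  then have "\<forall>\<^sub>F k in at_top. (\<eta> * k) ^ 1 / exp (\<eta> * k) < \<eta> * e"
    by (rule order_tendstoD) (use assms in simp)
  then show ?thesis
    by eventually_elim (use assms in \<open>simp add: exp_minus field_simps\<close>)
qed

lemma superlevel_uniformly_pos:
  fixes f g :: "'a::metric_space \<Rightarrow> real"
  assumes "compact S" "continuous_on UNIV f" "continuous_on UNIV g" "\<And>x. l \<le> f x \<Longrightarrow> 0 < g x"
  obtains \<eta> where "0 < \<eta>" "\<And>x. x \<in> S \<Longrightarrow> l \<le> f x \<Longrightarrow> \<eta> \<le> g x"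
proof -
  have "closed {x. l \<le> f x}" using assms(2) by (intro closed_Collect_le) auto
  then have "compact ({x. l \<le> f x} \<inter> S)" using assms(1) by (rule closed_Int_compact)
  moreover have "continuous_on ({x. l \<le> f x} \<inter> S) g"
    using assms(3) by (rule continuous_on_subset) simp
  ultimately obtain \<eta> where "0 < \<eta>" "\<And>x. x \<in> {x. l \<le> f x} \<inter> S \<Longrightarrow> \<eta> \<le> g x"
    by (rule compact_uniformly_pos) (use assms(4) in auto)
  then show ?thesis using that by blast
qed

section \<open>Exponential barriers of a drifting pencil of circles\<close>

text \<open>
  A pencil of circles traversed by the parameter \<open>1 - exp (-\<epsilon> t)\<close>, which stays in \<open>[0, 1)\<close> for all
  \<open>t \<ge> 0\<close> and changes at a rate of at most \<open>\<epsilon>\<close>. One family therefore serves all large times.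
\<close>

locale drifting_pencil =
  fixes P0 P1 :: real and z0 z1 :: "real^2" and \<epsilon> :: real
begin

definition par :: "real \<Rightarrow> real" where "par t = 1 - exp (- \<epsilon> * t)"

definition centre :: "real \<Rightarrow> real^2" where
  "centre t = (1 - par t) *\<^sub>R z0 + par t *\<^sub>R z1"

definition rad2 :: "real \<Rightarrow> real" where
  "rad2 t = (1 - par t) * P0 + par t * P1 - par t * (1 - par t) * (norm (z0 - z1))\<^sup>2"

definition \<psi> :: "real^2 \<Rightarrow> real \<Rightarrow> real" where
  "\<psi> x t = (1 - par t) * (P0 - (norm (x - z0))\<^sup>2) + par t * (P1 - (norm (x - z1))\<^sup>2)"

text \<open>
  The time derivative of \<open>\<psi>\<close>, see \<open>\<psi>_has_derivative\<close>.
\<close>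

definition speed :: "real^2 \<Rightarrow> real \<Rightarrow> real" where
  "speed x t = \<epsilon> * exp (- \<epsilon> * t) * ((P1 - (norm (x - z1))\<^sup>2) - (P0 - (norm (x - z0))\<^sup>2))"

text \<open>
  Upper barriers have \<open>A, \<kappa>, B > 0\<close> and lower barriers \<open>A, \<kappa>, B < 0\<close>. In both cases \<open>A \<kappa> > 0\<close>, so a barrier
  increases with \<open>\<psi>\<close>, and at each time its level sets are circles about \<open>centre t\<close>. The last summand
  depends on time only; it makes the barrier strict and keeps touching points away from the final time.
\<close>

definition barrier :: "real \<Rightarrow> real \<Rightarrow> real \<Rightarrow> real \<Rightarrow> real \<Rightarrow> real \<Rightarrow> (real^2) \<times> real \<Rightarrow> real" where
  "barrier c A \<kappa> B N T w =
     c + A * exp (\<kappa> * \<psi> (fst w) (snd w)) + B * exp (N * (snd w - T))"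

text \<open>
  Completing the square: every member of the pencil is a circle, and \<open>\<psi>\<close> is its squared radius minus
  the squared distance from its centre.
\<close>

lemma \<psi>_circle: "\<psi> x t = rad2 t - (norm (x - centre t))\<^sup>2"
  unfolding \<psi>_def rad2_def centre_def power2_norm_eq_inner
  by (simp add: inner_simps inner_commute algebra_simps power2_eq_square)

lemma barrier_smooth: "smooth_on S (barrier c A \<kappa> B N T)"
proof -
  have bl: "bounded_linear (\<lambda>w::(real^2)\<times>real. fst w $ i)" for i
    by (intro bounded_linear_compose[OF bounded_linear_vec_nth] bounded_linear_fst)
  have "Ck_on k UNIV (barrier c A \<kappa> B N T)" for k
    unfolding barrier_def \<psi>_def par_def power2_norm_eq_inner inner_vec_def sum_2
      vector_minus_component inner_real_def
    by (intro Ck_on_add Ck_on_diff Ck_on_mult Ck_on_exp Ck_on_const Ck_on_bounded_linear[OF bl]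
        Ck_on_bounded_linear[OF bounded_linear_snd])
  then show ?thesis unfolding smooth_on_def by (blast intro: Ck_on_mono)
qed

lemma \<psi>_has_derivative:
  "((\<lambda>w. \<psi> (fst w) (snd w)) has_derivative
     (\<lambda>h. - 2 * ((x - centre t) \<bullet> fst h) + speed x t * snd h)) (at (x, t))"
  unfolding \<psi>_def par_def power2_norm_eq_inner
  by (rule derivative_eq_intros refl | simp)+
     (auto simp: fun_eq_iff speed_def centre_def par_def inner_simps inner_commute
        algebra_simps power2_norm_eq_inner)

lemma barrier_has_derivative:
  "(barrier c A \<kappa> B N T has_derivative
     (\<lambda>h. A * \<kappa> * exp (\<kappa> * \<psi> x t) * (- 2 * ((x - centre t) \<bullet> fst h) + speed x t * snd h)
        + B * N * exp (N * (t - T)) * snd h)) (at (x, t))"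
  unfolding barrier_def
  by (rule derivative_eq_intros \<psi>_has_derivative refl | simp)+ (auto simp: fun_eq_iff algebra_simps)

lemma time_deriv_barrier:
  "time_deriv (barrier c A \<kappa> B N T) (x, t)
     = A * \<kappa> * exp (\<kappa> * \<psi> x t) * speed x t + B * N * exp (N * (t - T))"
  unfolding time_deriv_def frechet_derivative_at[OF barrier_has_derivative, symmetric] by simp

lemma space_partial_barrier:
  "space_partial i (barrier c A \<kappa> B N T) w
     = - 2 * A * \<kappa> * exp (\<kappa> * \<psi> (fst w) (snd w)) * (fst w - centre (snd w)) $ i"
  by (cases w) (simp add: space_partial_def inner_axis
      frechet_derivative_at[OF barrier_has_derivative, symmetric] algebra_simps)

lemma space_grad_barrier:
  "space_grad (barrier c A \<kappa> B N T) (x, t)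
     = (- 2 * A * \<kappa> * exp (\<kappa> * \<psi> x t)) *\<^sub>R (x - centre t)"
  by (simp add: space_grad_def space_partial_barrier vec_eq_iff)

lemma space_hessian_barrier:
  "space_hessian (barrier c A \<kappa> B N T) (x, t) =
     (- 2 * A * \<kappa> * exp (\<kappa> * \<psi> x t)) *\<^sub>R mat 1
     + (4 * A * \<kappa>\<^sup>2 * exp (\<kappa> * \<psi> x t)) *\<^sub>R tensor_square (x - centre t)"
proof -
  have "space_partial i (space_partial j (barrier c A \<kappa> B N T)) (x, t)
     = - 2 * A * \<kappa> * exp (\<kappa> * \<psi> x t) * (if i = j then 1 else 0)
     + 4 * A * \<kappa>\<^sup>2 * exp (\<kappa> * \<psi> x t) * (x - centre t) $ i * (x - centre t) $ j" for i j
  proof -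
    have cd: "((\<lambda>w::(real^2)\<times>real. (fst w - centre (snd w)) $ j) has_derivative
        (\<lambda>h. (fst h - (\<epsilon> * exp (- \<epsilon> * t) * snd h) *\<^sub>R (z1 - z0)) $ j)) (at (x, t))"
      unfolding centre_def par_def vector_minus_component vector_add_component vector_scaleR_component
      by (rule derivative_eq_intros refl bounded_linear.has_derivative[OF bounded_linear_vec_nth] | simp)+
         (auto simp: fun_eq_iff algebra_simps)
    have "((\<lambda>w. - 2 * A * \<kappa> * exp (\<kappa> * \<psi> (fst w) (snd w)) * (fst w - centre (snd w)) $ j)
       has_derivative
       (\<lambda>h. - 2 * A * \<kappa> * exp (\<kappa> * \<psi> x t) *
          (fst h - (\<epsilon> * exp (- \<epsilon> * t) * snd h) *\<^sub>R (z1 - z0)) $ j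
         - 2 * A * \<kappa> * (exp (\<kappa> * \<psi> x t)
              * (\<kappa> * (- 2 * ((x - centre t) \<bullet> fst h) + speed x t * snd h)))
            * (x - centre t) $ j)) (at (x, t))"
      by (rule derivative_eq_intros \<psi>_has_derivative cd refl | simp)+
         (auto simp: fun_eq_iff algebra_simps)
    note D = frechet_derivative_at[OF this, symmetric]
    have ax: "axis i (1::real) $ j = (if i = j then 1 else 0)" by (simp add: axis_def)
    show ?thesis
      unfolding space_partial_def[of i] space_partial_barrier[abs_def] D
      by (simp add: inner_axis ax power2_eq_square algebra_simps)
  qed
  then show ?thesis
    by (simp add: space_hessian_def vec_eq_iff mat_def tensor_square_def)
qed

end

context drifting_pencil
begin

text \<open>
  The Hessian of a barrier is \<open>-2E I\<close> plus a multiple of \<open>p \<otimes> p\<close>, where \<open>p\<close> is its gradient, so both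
  envelopes of the curvature operator reduce to \<open>2E\<close>. If \<open>E = 0\<close>, then \<open>p = 0\<close> and the multiple is \<open>0\<close>;
  the convention \<open>\<kappa> / 0 = 0\<close> gives the right value.
\<close>

lemma barrier_operator:
  fixes A \<kappa> t :: real and x :: "real^2"
  defines "E \<equiv> A * \<kappa> * exp (\<kappa> * \<psi> x t)"
  shows "ereal (2 * E) \<le> lsc_envelope curv_dom curv_op
           (space_grad (barrier c A \<kappa> B N T) (x, t), space_hessian (barrier c A \<kappa> B N T) (x, t))"
    and "usc_envelope curv_dom curv_op
           (space_grad (barrier c A \<kappa> B N T) (x, t), space_hessian (barrier c A \<kappa> B N T) (x, t))
         \<le> ereal (2 * E)"
    and "norm (space_grad (barrier c A \<kappa> B N T) (x, t)) = 2 * \<bar>E\<bar> * norm (x - centre t)"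
proof -
  define p where "p = space_grad (barrier c A \<kappa> B N T) (x, t)"
  have p: "p = (- 2 * E) *\<^sub>R (x - centre t)"
    unfolding p_def space_grad_barrier E_def by simp
  have "tensor_square p = (4 * E\<^sup>2) *\<^sub>R tensor_square (x - centre t)"
    by (simp add: p tensor_square_def vec_eq_iff power2_eq_square algebra_simps)
  moreover have "(\<kappa> / E) * (4 * E\<^sup>2) = 4 * A * \<kappa>\<^sup>2 * exp (\<kappa> * \<psi> x t)"
    by (simp add: E_def power2_eq_square)
  ultimately have "(4 * A * \<kappa>\<^sup>2 * exp (\<kappa> * \<psi> x t)) *\<^sub>R tensor_square (x - centre t)
      = (\<kappa> / E) *\<^sub>R tensor_square p"
    by simp
  then have X: "space_hessian (barrier c A \<kappa> B N T) (x, t)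
      = (- 2 * E) *\<^sub>R mat 1 + (\<kappa> / E) *\<^sub>R tensor_square p"
    unfolding space_hessian_barrier by (simp add: E_def)
  show "ereal (2 * E) \<le> lsc_envelope curv_dom curv_op
           (space_grad (barrier c A \<kappa> B N T) (x, t), space_hessian (barrier c A \<kappa> B N T) (x, t))"
    using curv_envelopes(1)[of "- 2 * E" p "\<kappa> / E"] unfolding X p_def[symmetric] by simp
  show "usc_envelope curv_dom curv_op
           (space_grad (barrier c A \<kappa> B N T) (x, t), space_hessian (barrier c A \<kappa> B N T) (x, t))
         \<le> ereal (2 * E)"
    using curv_envelopes(2)[of p "- 2 * E" "\<kappa> / E"] unfolding X p_def[symmetric] by simp
  show "norm (space_grad (barrier c A \<kappa> B N T) (x, t)) = 2 * \<bar>E\<bar> * norm (x - centre t)"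
    unfolding p_def[symmetric] p by (simp add: abs_mult)
qed

text \<open>
  Let \<open>r > 0\<close> be the distance of the touching point from the centre. After division by
  \<open>A \<kappa> exp (\<kappa> \<psi>) > 0\<close> the first summand is \<open>2 r (V - (\<nu> - 1/r))\<close>,
  where \<open>V\<close> is the outward normal speed of the level circle through the touching point. It is positive
  exactly if this circle moves outwards strictly faster than the law \<open>V = -\<kappa> + \<nu>\<close> prescribes.
\<close>

lemma subsolution_touches_barrier:
  assumes "viscosity_subsolution \<nu> \<Psi>m \<Psi>p u0 u" "continuous_on (UNIV \<times> {0..}) u"
    and "0 < t0" "\<Psi>m x0 < u (x0, t0)" "0 < A * \<kappa>"
    and "\<forall>\<^sub>F z in nhds (x0, t0). u z - barrier c A \<kappa> B N T z \<le> u (x0, t0) - barrier c A \<kappa> B N T (x0, t0)"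
  shows "A * \<kappa> * exp (\<kappa> * \<psi> x0 t0) * (speed x0 t0 + 2 - 2 * \<nu> * norm (x0 - centre t0))
      + B * N * exp (N * (t0 - T)) \<le> 0"
proof -
  define E where "E = A * \<kappa> * exp (\<kappa> * \<psi> x0 t0)"
  have "0 < E" using assms by (simp add: E_def)
  let ?\<phi> = "barrier c A \<kappa> B N T"
  have "ereal (time_deriv ?\<phi> (x0, t0) - \<nu> * norm (space_grad ?\<phi> (x0, t0))) + ereal (2 * E)
     \<le> ereal (time_deriv ?\<phi> (x0, t0) - \<nu> * norm (space_grad ?\<phi> (x0, t0)))
          + lsc_envelope curv_dom curv_op (space_grad ?\<phi> (x0, t0), space_hessian ?\<phi> (x0, t0))"
    unfolding E_def by (intro add_left_mono barrier_operator)
  also have "\<dots> \<le> 0"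
    by (rule subsolution_touch[OF assms(1,2) barrier_smooth assms(3,6,4)])
  finally have "time_deriv ?\<phi> (x0, t0) - \<nu> * (2 * \<bar>E\<bar> * norm (x0 - centre t0)) + 2 * E \<le> 0"
    unfolding barrier_operator(3) E_def[symmetric] by simp
  then show ?thesis
    using \<open>0 < E\<close> unfolding time_deriv_barrier E_def[symmetric] by (simp add: algebra_simps)
qed

lemma supersolution_touches_barrier:
  assumes "viscosity_supersolution \<nu> \<Psi>m \<Psi>p u0 u" "continuous_on (UNIV \<times> {0..}) u"
    and "0 < t0" "u (x0, t0) < \<Psi>p x0" "0 < A * \<kappa>"
    and "\<forall>\<^sub>F z in nhds (x0, t0). u z - barrier c A \<kappa> B N T z \<ge> u (x0, t0) - barrier c A \<kappa> B N T (x0, t0)"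
  shows "A * \<kappa> * exp (\<kappa> * \<psi> x0 t0) * (speed x0 t0 + 2 - 2 * \<nu> * norm (x0 - centre t0))
      + B * N * exp (N * (t0 - T)) \<ge> 0"
proof -
  define E where "E = A * \<kappa> * exp (\<kappa> * \<psi> x0 t0)"
  have "0 < E" using assms by (simp add: E_def)
  let ?\<phi> = "barrier c A \<kappa> B N T"
  have "0 \<le> ereal (time_deriv ?\<phi> (x0, t0) - \<nu> * norm (space_grad ?\<phi> (x0, t0)))
          + usc_envelope curv_dom curv_op (space_grad ?\<phi> (x0, t0), space_hessian ?\<phi> (x0, t0))"
    by (rule supersolution_touch[OF assms(1,2) barrier_smooth assms(3,6,4)])
  also have "\<dots> \<le> ereal (time_deriv ?\<phi> (x0, t0) - \<nu> * norm (space_grad ?\<phi> (x0, t0))) + ereal (2 * E)"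
    unfolding E_def by (intro add_left_mono barrier_operator)
  finally have "time_deriv ?\<phi> (x0, t0) - \<nu> * (2 * \<bar>E\<bar> * norm (x0 - centre t0)) + 2 * E \<ge> 0"
    unfolding barrier_operator(3) E_def[symmetric] by simp
  then show ?thesis
    using \<open>0 < E\<close> unfolding time_deriv_barrier E_def[symmetric] by (simp add: algebra_simps)
qed

lemma continuous_on_barrier: "continuous_on S (barrier c A \<kappa> B N T)"
  using barrier_smooth[of S c A \<kappa> B N T] unfolding smooth_on_def by (metis Ck_on.simps(1))

lemma par_bounds: "0 \<le> \<epsilon> \<Longrightarrow> 0 \<le> t \<Longrightarrow> 0 \<le> par t \<and> par t < 1"
  by (simp add: par_def)

lemma \<psi>_start: "\<psi> x 0 = P0 - (norm (x - z0))\<^sup>2"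
  by (simp add: \<psi>_def par_def)

lemma \<psi>_tendsto: 
  assumes "0 < \<epsilon>" shows "((\<lambda>t. \<psi> x t) \<longlongrightarrow> P1 - (norm (x - z1))\<^sup>2) at_top"
proof -
  have "filterlim (\<lambda>t. \<epsilon> * t) at_top at_top"
    using assms by (auto intro!: filterlim_tendsto_pos_mult_at_top[of _ \<epsilon>] filterlim_ident)
  then have "filterlim (\<lambda>t. - \<epsilon> * t) at_bot at_top"
    by (simp add: filterlim_uminus_at_bot)
  then have "((\<lambda>t. exp (- \<epsilon> * t)) \<longlongrightarrow> 0) at_top"
    by (rule filterlim_compose[OF exp_at_bot])
  then have "(par \<longlongrightarrow> 1 - 0) at_top"
    unfolding par_def by (intro tendsto_intros)
  then have "((\<lambda>t. \<psi> x t) \<longlongrightarrow> (1 - (1 - 0)) * (P0 - (norm (x - z0))\<^sup>2) + (1 - 0) * (P1 - (norm (x - z1))\<^sup>2)) at_top"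
    unfolding \<psi>_def by (intro tendsto_intros)
  then show ?thesis by simp
qed

lemma abs_speed_le:
  assumes "0 < \<epsilon>" "0 \<le> t" "\<bar>(P1 - (norm (x - z1))\<^sup>2) - (P0 - (norm (x - z0))\<^sup>2)\<bar> \<le> C"
  shows "\<bar>speed x t\<bar> \<le> \<epsilon> * C"
proof -
  have "\<bar>speed x t\<bar> = (\<epsilon> * exp (- \<epsilon> * t)) * \<bar>(P1 - (norm (x - z1))\<^sup>2) - (P0 - (norm (x - z0))\<^sup>2)\<bar>"
    using assms by (simp add: speed_def abs_mult)
  also have "\<dots> \<le> \<epsilon> * C"
    using assms by (intro mult_mono) auto
  finally show ?thesis .
qed

end

section \<open>Comparison with the barriers\<close>

context drifting_pencil
begin

lemma speed_bound_on_compact: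
  assumes "compact \<Omega>"
  obtains G where "0 < G"
    "\<And>x t. x \<in> \<Omega> \<Longrightarrow> 0 \<le> t \<Longrightarrow> t \<le> T \<Longrightarrow> \<bar>speed x t + 2 - 2 * \<nu> * norm (x - centre t)\<bar> \<le> G"
proof -
  have "compact (\<Omega> \<times> {0..T})" using assms by (intro compact_Times) auto
  moreover have "continuous_on (\<Omega> \<times> {0..T})
      (\<lambda>w. speed (fst w) (snd w) + 2 - 2 * \<nu> * norm (fst w - centre (snd w)))"
    unfolding speed_def centre_def par_def by (intro continuous_intros)
  ultimately obtain G where "0 < G" "\<And>w. w \<in> \<Omega> \<times> {0..T} \<Longrightarrow>
      \<bar>speed (fst w) (snd w) + 2 - 2 * \<nu> * norm (fst w - centre (snd w))\<bar> \<le> G"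
    using compact_abs_bound by blast
  then show ?thesis using that by force
qed

lemma \<psi>_ge:
  assumes "0 \<le> \<epsilon>" "0 \<le> t" "\<eta> \<le> P0 - (norm (x - z0))\<^sup>2" "\<eta> \<le> P1 - (norm (x - z1))\<^sup>2"
  shows "\<eta> \<le> \<psi> x t"
  unfolding \<psi>_def using par_bounds[OF assms(1,2)] assms(3,4)
    convex_bound_le[of "- (P0 - (norm (x - z0))\<^sup>2)" "- \<eta>" "- (P1 - (norm (x - z1))\<^sup>2)" "1 - par t" "par t"]
  by (simp add: algebra_simps)

lemma \<psi>_le:
  assumes "0 \<le> \<epsilon>" "0 \<le> t" "P0 - (norm (x - z0))\<^sup>2 \<le> \<eta>" "P1 - (norm (x - z1))\<^sup>2 \<le> \<eta>"
  shows "\<psi> x t \<le> \<eta>"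
  unfolding \<psi>_def using par_bounds[OF assms(1,2)] assms(3,4)
    convex_bound_le[of "(P0 - (norm (x - z0))\<^sup>2)" "\<eta>" "(P1 - (norm (x - z1))\<^sup>2)" "1 - par t" "par t"]
  by (simp add: algebra_simps)

text \<open>
  The hypothesis \<open>slow\<close> says that the level circles of \<open>\<psi>\<close> through points with \<open>\<psi> > -\<eta>0\<close>, inner ones
  included, shrink more slowly than the law of motion requires. Level circles further out may have radius
  larger than \<open>1/\<nu>\<close> and violate this; there \<open>k exp (k \<psi>)\<close> is small and the purely time-dependent term decides.
  The order of choice matters: the growth rate \<open>N\<close> depends on bounds for \<open>u\<close> up to time \<open>t1 + 1\<close>, and
  \<open>k\<close> is taken large depending on \<open>N\<close>.
\<close>

lemma upper_bound_outside_disc: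
  assumes \<epsilon>: "0 < \<epsilon>" and sub: "viscosity_subsolution \<nu> \<Psi>m \<Psi>p u0 u"
    and cont: "continuous_on (UNIV \<times> {0..}) u" and contm: "continuous_on UNIV \<Psi>m"
    and ac: "a \<le> c" and t1: "0 < t1"
    and far: "\<And>x t. R \<le> norm x \<Longrightarrow> 0 \<le> t \<Longrightarrow> t \<le> t1 + 1 \<Longrightarrow> u (x, t) = a"
    and \<eta>0: "0 < \<eta>0"
    and slow: "\<And>x t. 0 \<le> t \<Longrightarrow> - \<eta>0 < \<psi> x t \<Longrightarrow> 0 < speed x t + 2 - 2 * \<nu> * norm (x - centre t)"
    and init: "\<And>x. c < u (x, 0) \<Longrightarrow> (norm (x - z0))\<^sup>2 < P0"
    and obst: "\<And>x. c < \<Psi>m x \<Longrightarrow> (norm (x - z0))\<^sup>2 < P0 \<and> (norm (x - z1))\<^sup>2 < P1"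
    and out: "\<psi> x1 t1 \<le> 0"
  shows "u (x1, t1) \<le> c"
proof (rule ccontr)
  assume "\<not> u (x1, t1) \<le> c"
  define \<delta> where "\<delta> = (u (x1, t1) - c) / 3"
  have \<delta>: "0 < \<delta>" "c + 2 * \<delta> < u (x1, t1)"
    using \<open>\<not> u (x1, t1) \<le> c\<close> by (auto simp: \<delta>_def field_simps)
  \<comment> \<open>The extra unit of time lets the last term of the barrier grow from \<open>\<delta>\<close> to \<open>\<delta> exp N\<close>.\<close>
  define T where "T = t1 + 1"
  define \<Omega> where "\<Omega> = cball (0 :: real^2) R"
  have comp: "compact \<Omega>" by (simp add: \<Omega>_def)
  have sub\<Omega>: "\<Omega> \<times> {0..T} \<subseteq> UNIV \<times> {0..}" by auto
  have x1: "x1 \<in> \<Omega>"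
    using far[of x1 t1] \<delta> ac t1 by (force simp: \<Omega>_def)
  obtain M where M: "0 < M" "\<And>x t. x \<in> \<Omega> \<Longrightarrow> 0 \<le> t \<Longrightarrow> t \<le> T \<Longrightarrow> \<bar>u (x, t)\<bar> \<le> M"
  proof -
    have "compact (\<Omega> \<times> {0..T})" using comp by (intro compact_Times) auto
    then obtain M where "0 < M" "\<And>w. w \<in> \<Omega> \<times> {0..T} \<Longrightarrow> \<bar>u w\<bar> \<le> M"
      using compact_abs_bound continuous_on_subset[OF cont sub\<Omega>] by metis
    then show ?thesis using that by force
  qed
  obtain G where G: "0 < G"
    "\<And>x t. x \<in> \<Omega> \<Longrightarrow> 0 \<le> t \<Longrightarrow> t \<le> T \<Longrightarrow> \<bar>speed x t + 2 - 2 * \<nu> * norm (x - centre t)\<bar> \<le> G"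
    using speed_bound_on_compact[OF comp] by blast
  obtain \<eta>1 where \<eta>1: "0 < \<eta>1"
    "\<And>x. x \<in> \<Omega> \<Longrightarrow> c + \<delta> \<le> u (x, 0) \<Longrightarrow> \<eta>1 \<le> P0 - (norm (x - z0))\<^sup>2"
  proof (rule superlevel_uniformly_pos[OF comp, of "\<lambda>x. u (x, 0)" "\<lambda>x. P0 - (norm (x - z0))\<^sup>2" "c + \<delta>"])
    show "continuous_on UNIV (\<lambda>x. u (x, 0))"
      by (rule continuous_on_compose2[OF cont]) (auto intro!: continuous_intros)
    show "continuous_on UNIV (\<lambda>x. P0 - (norm (x - z0))\<^sup>2)" by (intro continuous_intros)
    show "0 < P0 - (norm (x - z0))\<^sup>2" if "c + \<delta> \<le> u (x, 0)" for x
      using init[of x] that \<delta> by auto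
  qed (use that in blast)
  obtain \<eta>2 where \<eta>2: "0 < \<eta>2"
    "\<And>x. x \<in> \<Omega> \<Longrightarrow> c + \<delta> \<le> \<Psi>m x \<Longrightarrow> \<eta>2 \<le> min (P0 - (norm (x - z0))\<^sup>2) (P1 - (norm (x - z1))\<^sup>2)"
  proof (rule superlevel_uniformly_pos[OF comp, of \<Psi>m
        "\<lambda>x. min (P0 - (norm (x - z0))\<^sup>2) (P1 - (norm (x - z1))\<^sup>2)" "c + \<delta>"])
    show "continuous_on UNIV \<Psi>m" by (rule contm)
    show "continuous_on UNIV (\<lambda>x. min (P0 - (norm (x - z0))\<^sup>2) (P1 - (norm (x - z1))\<^sup>2))"
      by (intro continuous_intros)
    show "0 < min (P0 - (norm (x - z0))\<^sup>2) (P1 - (norm (x - z1))\<^sup>2)" if "c + \<delta> \<le> \<Psi>m x" for x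
      using obst[of x] that \<delta> by auto
  qed (use that in blast)
  define \<eta> where "\<eta> = min \<eta>1 \<eta>2"
  have \<eta>: "0 < \<eta>" "\<eta> \<le> \<eta>1" "\<eta> \<le> \<eta>2" using \<eta>1 \<eta>2 by (auto simp: \<eta>_def)
  \<comment> \<open>Since \<open>exp N \<ge> N\<close>, the last term alone takes the barrier past the bound \<open>M\<close> at time \<open>T\<close>.\<close>
  define N where "N = (M + \<bar>c\<bar> + 1) / \<delta>"
  have N: "0 < N" "M < c + \<delta> * exp N"
  proof -
    show "0 < N" using M \<delta> by (auto simp: N_def intro!: divide_pos_pos)
    have "\<delta> * N \<le> \<delta> * exp N" using \<delta> exp_ge_add_one_self[of N] by (intro mult_left_mono) linarith+
    then show "M < c + \<delta> * exp N" using \<delta> by (simp add: N_def)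
  qed
  \<comment> \<open>On the right is the least growth rate of the last term, compared with the bound \<open>G\<close>; \<open>\<delta>\<close> cancels.\<close>
  have "\<forall>\<^sub>F k in at_top. k * exp (- (k * \<eta>0)) < N * exp (- (N * t1)) / G"
    using G N by (intro mult_exp_small \<eta>0) auto
  then have "\<forall>\<^sub>F k in at_top. k * exp (- (k * \<eta>0)) < N * exp (- (N * t1)) / G \<and> N / \<eta> \<le> k"
    by (intro eventually_conj eventually_ge_at_top)
  then obtain k where k: "k * exp (- (k * \<eta>0)) < N * exp (- (N * t1)) / G" "N / \<eta> \<le> k"
    unfolding eventually_at_top_linorder by blast
  have kpos: "0 < k" using k(2) N \<eta> by (meson divide_pos_pos less_le_trans)
  have k\<eta>: "N \<le> k * \<eta>" using k(2) \<eta> by (simp add: field_simps)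
  define \<phi> where "\<phi> = barrier c \<delta> k \<delta> N t1"
  have \<phi>: "\<phi> (x, t) = c + \<delta> * exp (k * \<psi> x t) + \<delta> * exp (N * (t - t1))" for x t
    by (simp add: \<phi>_def barrier_def)
  have base: "c < \<phi> (x, t)" for x t using \<delta> by (simp add: \<phi> add_pos_pos)
  have inner: "c + \<delta> < \<phi> (x, t)" if "0 < \<psi> x t" for x t
  proof -
    have "\<delta> * 1 \<le> \<delta> * exp (k * \<psi> x t)"
      using \<delta> kpos that by (intro mult_left_mono) auto
    then show ?thesis using \<delta> unfolding \<phi> by (smt (verit) mult_pos_pos exp_gt_zero)
  qed
  have deep: "M < \<phi> (x, t)" if "\<eta> \<le> \<psi> x t" for x t
  proof -
    have "k * \<eta> \<le> k * \<psi> x t" using that kpos by simp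
    then have "\<delta> * exp N \<le> \<delta> * exp (k * \<psi> x t)"
      using \<delta> k\<eta> by (intro mult_left_mono) auto
    then show ?thesis using \<delta> N unfolding \<phi> by (smt (verit) mult_pos_pos exp_gt_zero)
  qed
  have bottom: "u (x, 0) < \<phi> (x, 0)" if "x \<in> \<Omega>" for x
  proof -
    consider "u (x, 0) \<le> c" | "c < u (x, 0)" "u (x, 0) \<le> c + \<delta>" | "c + \<delta> \<le> u (x, 0)" by linarith
    then show ?thesis
    proof cases
      case 1 then show ?thesis using base[of x 0] by linarith
    next
      case 2 then show ?thesis using inner[of x 0] init[of x] by (simp add: \<psi>_start)
    next
      case 3
      then have "\<eta> \<le> \<psi> x 0" using \<eta>1(2)[OF that] \<eta> by (simp add: \<psi>_start)
      then show ?thesis using deep[of x 0] M(2)[OF that, of 0] t1 by (auto simp: T_def)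
    qed
  qed
  have top: "u (x, T) < \<phi> (x, T)" if "x \<in> \<Omega>" for x
  proof -
    have "M < c + \<delta> * exp (N * (T - t1))" using N by (simp add: T_def)
    also have "\<dots> < \<phi> (x, T)" using \<delta> by (simp add: \<phi>)
    finally show ?thesis using M(2)[OF that, of T] t1 by (auto simp: T_def)
  qed
  have side: "u (x, t) < \<phi> (x, t)" if "x \<in> \<Omega>" "x \<notin> interior \<Omega>" "0 \<le> t" "t \<le> T" for x t
    using far[of x t] that base[of x t] ac by (auto simp: \<Omega>_def T_def)
  have start: "\<phi> (x1, t1) < u (x1, t1)"
  proof -
    have "\<delta> * exp (k * \<psi> x1 t1) \<le> \<delta> * 1"
      using \<delta> kpos out by (intro mult_left_mono) (auto simp: mult_le_0_iff)
    moreover have "\<phi> (x1, t1) = c + \<delta> * exp (k * \<psi> x1 t1) + \<delta>" by (simp add: \<phi>)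
    ultimately show ?thesis using \<delta> by linarith
  qed
  obtain x0 t0 where z: "x0 \<in> interior \<Omega>" "0 < t0" "t0 < T" "\<phi> (x0, t0) < u (x0, t0)"
    "\<forall>\<^sub>F z in nhds (x0, t0). u z - \<phi> z \<le> u (x0, t0) - \<phi> (x0, t0)"
  proof (rule interior_touch[OF comp, of T u \<phi> x1 t1])
    show "continuous_on (\<Omega> \<times> {0..T}) u" using cont sub\<Omega> by (rule continuous_on_subset)
    show "continuous_on (\<Omega> \<times> {0..T}) \<phi>" unfolding \<phi>_def by (rule continuous_on_barrier)
  qed (use x1 t1 start bottom top side in \<open>auto simp: T_def\<close>)
  have x0: "x0 \<in> \<Omega>" using z(1) interior_subset by blast
  have "\<Psi>m x0 < u (x0, t0)"
  proof -
    consider "\<Psi>m x0 \<le> c" | "c < \<Psi>m x0" "\<Psi>m x0 \<le> c + \<delta>" | "c + \<delta> \<le> \<Psi>m x0" by linarith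
    then have "\<Psi>m x0 \<le> \<phi> (x0, t0) \<or> M < \<phi> (x0, t0)"
    proof cases
      case 1 then show ?thesis using base[of x0 t0] by linarith
    next
      case 2
      define e where "e = min (P0 - (norm (x0 - z0))\<^sup>2) (P1 - (norm (x0 - z1))\<^sup>2)"
      have "0 < e" "e \<le> \<psi> x0 t0"
        using obst[OF 2(1)] \<epsilon> z by (auto simp: e_def intro!: \<psi>_ge)
      then show ?thesis using inner[of x0 t0] 2(2) by auto
    next
      case 3
      then have "\<eta> \<le> \<psi> x0 t0" using \<eta>2(2)[OF x0] \<eta> \<epsilon> z by (intro \<psi>_ge) auto
      then show ?thesis using deep by blast
    qed
    then show ?thesis using z M(2)[OF x0, of t0] by auto
  qed
  then have ineq: "\<delta> * k * exp (k * \<psi> x0 t0) * (speed x0 t0 + 2 - 2 * \<nu> * norm (x0 - centre t0))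
      + \<delta> * N * exp (N * (t0 - t1)) \<le> 0"
    using z \<delta> kpos
    by (intro subsolution_touches_barrier[OF sub cont, where c = c]) (auto simp: \<phi>_def)
  let ?v = "speed x0 t0 + 2 - 2 * \<nu> * norm (x0 - centre t0)"
  have drift: "\<delta> * (N * exp (- (N * t1))) \<le> \<delta> * N * exp (N * (t0 - t1))"
  proof -
    have "- (N * t1) \<le> N * (t0 - t1)" using N z by (simp add: algebra_simps)
    then show ?thesis using \<delta> N by simp
  qed
  have "- (k * exp (k * \<psi> x0 t0) * ?v) < N * exp (- (N * t1))"
  proof (cases "- \<eta>0 < \<psi> x0 t0")
    case True
    then have "0 < k * exp (k * \<psi> x0 t0) * ?v" using slow[of t0 x0] z kpos by simp
    moreover have "0 < N * exp (- (N * t1))" using N by simp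
    ultimately show ?thesis by linarith
  next
    case False
    then have "k * \<psi> x0 t0 \<le> k * (- \<eta>0)" using kpos by (intro mult_left_mono) auto
    then have "k * exp (k * \<psi> x0 t0) \<le> k * exp (- (k * \<eta>0))" using kpos by simp
    moreover have "\<bar>?v\<bar> \<le> G" using G(2)[OF x0, of t0] z by simp
    ultimately have "k * exp (k * \<psi> x0 t0) * \<bar>?v\<bar> \<le> k * exp (- (k * \<eta>0)) * G"
      using kpos by (intro mult_mono) auto
    also have "\<dots> < N * exp (- (N * t1))" using k(1) G(1) by (simp add: field_simps)
    finally have "k * exp (k * \<psi> x0 t0) * \<bar>?v\<bar> < N * exp (- (N * t1))" .
    moreover have "- (k * exp (k * \<psi> x0 t0) * ?v) \<le> k * exp (k * \<psi> x0 t0) * \<bar>?v\<bar>"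
      unfolding mult_minus_right[symmetric] using kpos by (intro mult_left_mono) auto
    ultimately show ?thesis by linarith
  qed
  then have "\<delta> * - (k * exp (k * \<psi> x0 t0) * ?v) < \<delta> * (N * exp (- (N * t1)))"
    using \<delta> by (intro mult_strict_left_mono) auto
  then show False using ineq drift by (simp add: mult.assoc)
qed

text \<open>
  The mirror image of the upper bound, localised to a compact region \<open>\<Omega>\<close>. At its boundary the solution
  is either known to be at least \<open>c\<close>, or (on \<open>S\<close>) the point is outside all discs of the pencil, where the
  barrier is lower than any value of \<open>u\<close>. The same holds initially on all of \<open>\<Omega>\<close>, which
  is outside the first disc. The level circles deep inside may have radius
  less than \<open>1/\<nu>\<close>, and there the purely time-dependent term decides.
\<close>

lemma lower_bound_inside_disc:
  assumes \<epsilon>: "0 < \<epsilon>" and super: "viscosity_supersolution \<nu> \<Psi>m \<Psi>p u0 u"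
    and cont: "continuous_on (UNIV \<times> {0..}) u" and t1: "0 < t1"
    and comp: "compact \<Omega>" "compact S" "S \<subseteq> \<Omega>"
    and \<eta>0: "0 < \<eta>0"
    and slow: "\<And>x t. x \<in> \<Omega> \<Longrightarrow> 0 \<le> t \<Longrightarrow> \<psi> x t < \<eta>0 \<Longrightarrow> speed x t + 2 - 2 * \<nu> * norm (x - centre t) \<le> 0"
    and upper: "\<And>x. x \<in> \<Omega> \<Longrightarrow> c \<le> \<Psi>p x"
    and init: "\<And>x. x \<in> \<Omega> \<Longrightarrow> P0 < (norm (x - z0))\<^sup>2"
    and final: "\<And>x. x \<in> S \<Longrightarrow> P1 < (norm (x - z1))\<^sup>2"
    and side: "\<And>x t. x \<in> \<Omega> \<Longrightarrow> x \<notin> interior \<Omega> \<Longrightarrow> x \<notin> S \<Longrightarrow> 0 \<le> t \<Longrightarrow> c \<le> u (x, t)"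
    and x1: "x1 \<in> \<Omega>" "0 \<le> \<psi> x1 t1"
  shows "c \<le> u (x1, t1)"
proof (rule ccontr)
  assume "\<not> c \<le> u (x1, t1)"
  define \<delta> where "\<delta> = (c - u (x1, t1)) / 3"
  have \<delta>: "0 < \<delta>" "u (x1, t1) < c - 2 * \<delta>"
    using \<open>\<not> c \<le> u (x1, t1)\<close> by (auto simp: \<delta>_def field_simps)
  \<comment> \<open>The extra unit of time lets the last term of the barrier grow from \<open>\<delta>\<close> to \<open>\<delta> exp N\<close>.\<close>
  define T where "T = t1 + 1"
  have sub\<Omega>: "\<Omega> \<times> {0..T} \<subseteq> UNIV \<times> {0..}" by auto
  obtain M where M: "0 < M" "\<And>x t. x \<in> \<Omega> \<Longrightarrow> 0 \<le> t \<Longrightarrow> t \<le> T \<Longrightarrow> \<bar>u (x, t)\<bar> \<le> M"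
  proof -
    have "compact (\<Omega> \<times> {0..T})" using comp by (intro compact_Times) auto
    then obtain M where "0 < M" "\<And>w. w \<in> \<Omega> \<times> {0..T} \<Longrightarrow> \<bar>u w\<bar> \<le> M"
      using compact_abs_bound continuous_on_subset[OF cont sub\<Omega>] by metis
    then show ?thesis using that by force
  qed
  obtain G where G: "0 < G"
    "\<And>x t. x \<in> \<Omega> \<Longrightarrow> 0 \<le> t \<Longrightarrow> t \<le> T \<Longrightarrow> \<bar>speed x t + 2 - 2 * \<nu> * norm (x - centre t)\<bar> \<le> G"
    using speed_bound_on_compact[OF comp(1)] by blast
  obtain \<eta>1 where \<eta>1: "0 < \<eta>1" "\<And>x. x \<in> \<Omega> \<Longrightarrow> \<eta>1 \<le> (norm (x - z0))\<^sup>2 - P0"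
  proof (rule compact_uniformly_pos[OF comp(1), of "\<lambda>x. (norm (x - z0))\<^sup>2 - P0"])
    show "continuous_on \<Omega> (\<lambda>x. (norm (x - z0))\<^sup>2 - P0)" by (intro continuous_intros)
  qed (use init in auto)
  obtain \<eta>2 where \<eta>2: "0 < \<eta>2" "\<And>x. x \<in> S \<Longrightarrow> \<eta>2 \<le> (norm (x - z1))\<^sup>2 - P1"
  proof (rule compact_uniformly_pos[OF comp(2), of "\<lambda>x. (norm (x - z1))\<^sup>2 - P1"])
    show "continuous_on S (\<lambda>x. (norm (x - z1))\<^sup>2 - P1)" by (intro continuous_intros)
  qed (use final in auto)
  define \<eta> where "\<eta> = min \<eta>1 \<eta>2"
  have \<eta>: "0 < \<eta>" "\<eta> \<le> \<eta>1" "\<eta> \<le> \<eta>2" using \<eta>1 \<eta>2 by (auto simp: \<eta>_def)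
  \<comment> \<open>Since \<open>exp N \<ge> N\<close>, the last term alone takes the barrier past the bound \<open>M\<close> at time \<open>T\<close>.\<close>
  define N where "N = (M + \<bar>c\<bar> + 1) / \<delta>"
  have N: "0 < N" "c - \<delta> * exp N < - M"
  proof -
    show "0 < N" using M \<delta> by (auto simp: N_def intro!: divide_pos_pos)
    have "\<delta> * N \<le> \<delta> * exp N" using \<delta> exp_ge_add_one_self[of N] by (intro mult_left_mono) linarith+
    then show "c - \<delta> * exp N < - M" using \<delta> by (simp add: N_def)
  qed
  \<comment> \<open>On the right is the least growth rate of the last term, compared with the bound \<open>G\<close>; \<open>\<delta>\<close> cancels.\<close>
  have "\<forall>\<^sub>F k in at_top. k * exp (- (k * \<eta>0)) < N * exp (- (N * t1)) / G"
    using G N by (intro mult_exp_small \<eta>0) auto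
  then have "\<forall>\<^sub>F k in at_top. k * exp (- (k * \<eta>0)) < N * exp (- (N * t1)) / G \<and> N / \<eta> \<le> k"
    by (intro eventually_conj eventually_ge_at_top)
  then obtain k where k: "k * exp (- (k * \<eta>0)) < N * exp (- (N * t1)) / G" "N / \<eta> \<le> k"
    unfolding eventually_at_top_linorder by blast
  have kpos: "0 < k" using k(2) N \<eta> by (meson divide_pos_pos less_le_trans)
  have k\<eta>: "N \<le> k * \<eta>" using k(2) \<eta> by (simp add: field_simps)
  define \<phi> where "\<phi> = barrier c (- \<delta>) (- k) (- \<delta>) N t1"
  have \<phi>: "\<phi> (x, t) = c - \<delta> * exp (- (k * \<psi> x t)) - \<delta> * exp (N * (t - t1))" for x t
    by (simp add: \<phi>_def barrier_def)
  have base: "\<phi> (x, t) < c" for x t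
    using \<delta> by (smt (verit) \<phi> mult_pos_pos exp_gt_zero)
  have deep: "\<phi> (x, t) < - M" if "\<psi> x t \<le> - \<eta>" for x t
  proof -
    have "k * \<psi> x t \<le> k * (- \<eta>)" using that kpos by (intro mult_left_mono) auto
    then have "\<delta> * exp N \<le> \<delta> * exp (- (k * \<psi> x t))"
      using \<delta> k\<eta> by (intro mult_left_mono) auto
    then show ?thesis using \<delta> N unfolding \<phi> by (smt (verit) mult_pos_pos exp_gt_zero)
  qed
  have bottom: "\<phi> (x, 0) < u (x, 0)" if "x \<in> \<Omega>" for x
  proof -
    have "\<psi> x 0 \<le> - \<eta>" using \<eta>1(2)[OF that] \<eta> by (simp add: \<psi>_start)
    then show ?thesis using deep[of x 0] M(2)[OF that, of 0] t1 by (auto simp: T_def)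
  qed
  have top: "\<phi> (x, T) < u (x, T)" if "x \<in> \<Omega>" for x
  proof -
    have "\<phi> (x, T) < c - \<delta> * exp (N * (T - t1))" using \<delta> by (simp add: \<phi>)
    also have "\<dots> < - M" using N by (simp add: T_def)
    finally show ?thesis using M(2)[OF that, of T] t1 by (auto simp: T_def)
  qed
  have side: "\<phi> (x, t) < u (x, t)" if "x \<in> \<Omega>" "x \<notin> interior \<Omega>" "0 \<le> t" "t \<le> T" for x t
  proof (cases "x \<in> S")
    case True
    then have "\<psi> x t \<le> - \<eta>"
      using \<eta>1(2)[OF that(1)] \<eta>2(2)[OF True] \<eta> \<epsilon> that by (intro \<psi>_le) auto
    then show ?thesis using deep[of x t] M(2)[OF that(1), of t] that by auto
  next
    case False
    then show ?thesis using side[OF that(1,2) False that(3)] base[of x t] by linarith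
  qed
  have start: "u (x1, t1) < \<phi> (x1, t1)"
  proof -
    have "\<delta> * exp (- (k * \<psi> x1 t1)) \<le> \<delta> * 1"
      using \<delta> kpos x1 by (intro mult_left_mono) auto
    moreover have "\<phi> (x1, t1) = c - \<delta> * exp (- (k * \<psi> x1 t1)) - \<delta>" by (simp add: \<phi>)
    ultimately show ?thesis using \<delta> by linarith
  qed
  obtain x0 t0 where z: "x0 \<in> interior \<Omega>" "0 < t0" "t0 < T" "- \<phi> (x0, t0) < - u (x0, t0)"
    "\<forall>\<^sub>F z in nhds (x0, t0). - u z - - \<phi> z \<le> - u (x0, t0) - - \<phi> (x0, t0)"
  proof (rule interior_touch[OF comp(1), of T "\<lambda>z. - u z" "\<lambda>z. - \<phi> z" x1 t1])
    show "continuous_on (\<Omega> \<times> {0..T}) (\<lambda>z. - u z)"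
      using continuous_on_subset[OF cont sub\<Omega>] by (rule continuous_on_minus)
    show "continuous_on (\<Omega> \<times> {0..T}) (\<lambda>z. - \<phi> z)"
      unfolding \<phi>_def by (intro continuous_on_minus continuous_on_barrier)
  qed (use x1 t1 start bottom top side in \<open>auto simp: T_def\<close>)
  have x0: "x0 \<in> \<Omega>" using z(1) interior_subset by blast
  have "u (x0, t0) < \<Psi>p x0" using z(4) base[of x0 t0] upper[OF x0] by linarith
  moreover have "\<forall>\<^sub>F z in nhds (x0, t0). u z - \<phi> z \<ge> u (x0, t0) - \<phi> (x0, t0)"
    using z(5) by eventually_elim simp
  ultimately have ineq: "- \<delta> * - k * exp (- k * \<psi> x0 t0) * (speed x0 t0 + 2 - 2 * \<nu> * norm (x0 - centre t0))
      + - \<delta> * N * exp (N * (t0 - t1)) \<ge> 0"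
    using z \<delta> kpos
    by (intro supersolution_touches_barrier[OF super cont, where c = c]) (auto simp: \<phi>_def)
  let ?v = "speed x0 t0 + 2 - 2 * \<nu> * norm (x0 - centre t0)"
  have drift: "\<delta> * (N * exp (- (N * t1))) \<le> \<delta> * N * exp (N * (t0 - t1))"
  proof -
    have "- (N * t1) \<le> N * (t0 - t1)" using N z by (simp add: algebra_simps)
    then show ?thesis using \<delta> N by simp
  qed
  have "k * exp (- (k * \<psi> x0 t0)) * ?v < N * exp (- (N * t1))"
  proof (cases "\<psi> x0 t0 < \<eta>0")
    case True
    then have "k * exp (- (k * \<psi> x0 t0)) * ?v \<le> 0"
      using slow[OF x0, of t0] z kpos by (intro mult_nonneg_nonpos) auto
    moreover have "0 < N * exp (- (N * t1))" using N by simp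
    ultimately show ?thesis by linarith
  next
    case False
    then have "k * \<eta>0 \<le> k * \<psi> x0 t0" using kpos by (intro mult_left_mono) auto
    then have "k * exp (- (k * \<psi> x0 t0)) \<le> k * exp (- (k * \<eta>0))" using kpos by simp
    moreover have "\<bar>?v\<bar> \<le> G" using G(2)[OF x0, of t0] z by simp
    ultimately have "k * exp (- (k * \<psi> x0 t0)) * \<bar>?v\<bar> \<le> k * exp (- (k * \<eta>0)) * G"
      using kpos by (intro mult_mono) auto
    also have "\<dots> < N * exp (- (N * t1))" using k(1) G(1) by (simp add: field_simps)
    finally have "k * exp (- (k * \<psi> x0 t0)) * \<bar>?v\<bar> < N * exp (- (N * t1))" .
    moreover have "k * exp (- (k * \<psi> x0 t0)) * ?v \<le> k * exp (- (k * \<psi> x0 t0)) * \<bar>?v\<bar>"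
      using kpos by (intro mult_left_mono) auto
    ultimately show ?thesis by linarith
  qed
  then have "\<delta> * (k * exp (- (k * \<psi> x0 t0)) * ?v) < \<delta> * (N * exp (- (N * t1)))"
    using \<delta> by (intro mult_strict_left_mono) auto
  then show False using ineq drift by (simp add: mult.assoc)
qed

end

section \<open>Large times\<close>

lemma disc_touch_radius_lt:
  fixes \<nu> Q :: real
  assumes "0 < \<nu>" "Q < (inverse \<nu>)\<^sup>2" "0 \<le> Q"
  shows "\<nu> * sqrt Q < 1"
proof -
  have "sqrt Q < inverse \<nu>" using assms by (intro real_less_lsqrt) auto
  then show ?thesis using assms(1) by (simp add: field_simps)
qed

lemma disc_touch_radius_gt:
  fixes \<nu> Q :: real
  assumes "0 < \<nu>" "(inverse \<nu>)\<^sup>2 < Q"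
  shows "1 < \<nu> * sqrt Q"
proof -
  have "inverse \<nu> < sqrt Q" using assms by (intro real_less_rsqrt)
  then show ?thesis using assms(1) by (simp add: field_simps)
qed

text \<open>
  The squared radius is a convex function of the pencil parameter, so the intermediate circles are smaller
  than \<open>1/\<nu>\<close> if the first and the last are. Points near or inside them lie in a ball that does not depend
  on time, so one drift speed \<open>\<epsilon>\<close> is slow enough for all of them.
\<close>

lemma eventually_below_outside_disc:
  fixes z0 z1 :: "real^2"
  assumes \<nu>: "0 < \<nu>" and sub: "viscosity_subsolution \<nu> \<Psi>m \<Psi>p u0 u"
    and K: "u \<in> K_class a" and contm: "continuous_on UNIV \<Psi>m" and ac: "a \<le> c"
    and P: "P0 < (inverse \<nu>)\<^sup>2" "P1 < (inverse \<nu>)\<^sup>2"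
    and init: "\<And>x. c < u (x, 0) \<Longrightarrow> (norm (x - z0))\<^sup>2 < P0"
    and obst: "\<And>x. c < \<Psi>m x \<Longrightarrow> (norm (x - z0))\<^sup>2 < P0 \<and> (norm (x - z1))\<^sup>2 < P1"
    and out: "P1 < (norm (x1 - z1))\<^sup>2"
  shows "\<exists>\<tau>>0. \<forall>t>\<tau>. u (x1, t) \<le> c"
proof -
  define m where "m = inverse \<nu>"
  define Q where "Q = max 0 (max P0 P1)"
  have Q: "0 \<le> Q" "Q < m\<^sup>2" "P0 \<le> Q" "P1 \<le> Q" using P \<nu> by (auto simp: Q_def m_def)
  define \<eta>0 where "\<eta>0 = (m\<^sup>2 - Q) / 2"
  have \<eta>0: "0 < \<eta>0" "Q + \<eta>0 < m\<^sup>2" using Q by (auto simp: \<eta>0_def field_simps)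
  define r where "r = sqrt (Q + \<eta>0)"
  have r: "0 \<le> r" "\<nu> * r < 1" "r \<le> m"
  proof -
    show "\<nu> * r < 1" unfolding r_def using \<nu> \<eta>0 Q by (intro disc_touch_radius_lt) (auto simp: m_def)
    then show "r \<le> m" using \<nu> by (simp add: m_def field_simps)
    show "0 \<le> r" using \<eta>0 Q by (simp add: r_def)
  qed
  define \<Omega> where "\<Omega> = cball (0 :: real^2) (norm z0 + norm z1 + m)"
  obtain C where C: "0 < C"
    "\<And>x. x \<in> \<Omega> \<Longrightarrow> \<bar>(P1 - (norm (x - z1))\<^sup>2) - (P0 - (norm (x - z0))\<^sup>2)\<bar> \<le> C"
  proof (rule compact_abs_bound[of \<Omega> "\<lambda>x. (P1 - (norm (x - z1))\<^sup>2) - (P0 - (norm (x - z0))\<^sup>2)"])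
    show "continuous_on \<Omega> (\<lambda>x. (P1 - (norm (x - z1))\<^sup>2) - (P0 - (norm (x - z0))\<^sup>2))"
      by (intro continuous_intros)
  qed (auto simp: \<Omega>_def)
  \<comment> \<open>The drift uses up half of the margin left by the motion of the circles.\<close>
  define \<epsilon> where "\<epsilon> = (1 - \<nu> * r) / C"
  have \<epsilon>: "0 < \<epsilon>" "\<epsilon> * C = 1 - \<nu> * r" using C r by (auto simp: \<epsilon>_def)
  interpret drifting_pencil P0 P1 z0 z1 \<epsilon> .
  have slow: "0 < speed x t + 2 - 2 * \<nu> * norm (x - centre t)" if t: "0 \<le> t" and "- \<eta>0 < \<psi> x t" for x t
  proof -
    have par: "0 \<le> par t" "par t < 1" using par_bounds[of t] \<epsilon> t by auto
    have "(1 - par t) * P0 + par t * P1 \<le> Q"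
      using par Q by (intro convex_bound_le) auto
    moreover have "0 \<le> par t * (1 - par t) * (norm (z0 - z1))\<^sup>2" using par by simp
    ultimately have "rad2 t \<le> Q" by (simp add: rad2_def)
    then have "(norm (x - centre t))\<^sup>2 \<le> Q + \<eta>0" using that by (simp add: \<psi>_circle)
    then have n: "norm (x - centre t) \<le> r" unfolding r_def by (rule real_le_rsqrt)
    have "norm (centre t) \<le> norm ((1 - par t) *\<^sub>R z0) + norm (par t *\<^sub>R z1)"
      unfolding centre_def by (rule norm_triangle_ineq)
    also have "\<dots> \<le> norm z0 + norm z1"
      using par by (intro add_mono) (auto simp: mult_left_le_one_le)
    finally have "norm x \<le> norm z0 + norm z1 + m"
      using norm_triangle_ineq[of "x - centre t" "centre t"] n r by simp
    then have "\<bar>speed x t\<bar> \<le> \<epsilon> * C" using C \<epsilon> t by (intro abs_speed_le) (auto simp: \<Omega>_def)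
    moreover have "\<nu> * norm (x - centre t) \<le> \<nu> * r" using n \<nu> by simp
    ultimately show ?thesis using \<epsilon> r by (simp add: abs_le_iff)
  qed
  have "\<forall>\<^sub>F t in at_top. \<psi> x1 t < 0"
    by (rule order_tendstoD(2)[OF \<psi>_tendsto]) (use \<epsilon> out in auto)
  then obtain \<tau> where \<tau>: "\<And>t. \<tau> \<le> t \<Longrightarrow> \<psi> x1 t < 0" unfolding eventually_at_top_linorder by blast
  have "u (x1, t) \<le> c" if t: "max \<tau> 1 < t" for t
  proof -
    obtain R where R: "0 < R" "\<And>x s. R \<le> norm x \<Longrightarrow> 0 \<le> s \<Longrightarrow> s \<le> t + 1 \<Longrightarrow> u (x, s) = a"
    proof -
      have "0 < t + 1" using t by simp
      then show ?thesis using K that unfolding K_class_def by blast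
    qed
    have cont: "continuous_on (UNIV \<times> {0..}) u" using K by (simp add: K_class_def)
    show ?thesis
      using that \<tau>[of t]
      by (intro upper_bound_outside_disc[OF \<epsilon>(1) sub cont contm ac _ R(2) \<eta>0(1) slow init obst]) auto
  qed
  then show ?thesis by (intro exI[of _ "max \<tau> 1"]) auto
qed

text \<open>
  Radii greater than \<open>1/\<nu>\<close> are not inherited by intermediate circles: the squared radius contains the
  term \<open>-s (1-s) |z0 - z1|\<^sup>2\<close>. The condition on \<open>P0\<close> makes the initial disc so large that this
  term is compensated.
\<close>

lemma eventually_above_inside_disc:
  fixes z0 z1 :: "real^2"
  assumes \<nu>: "0 < \<nu>" and super: "viscosity_supersolution \<nu> \<Psi>m \<Psi>p u0 u"
    and cont: "continuous_on (UNIV \<times> {0..}) u"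
    and comp: "compact \<Omega>" "compact S" "S \<subseteq> \<Omega>"
    and P: "(inverse \<nu>)\<^sup>2 < P1" "P1 + (norm (z0 - z1))\<^sup>2 \<le> P0"
    and upper: "\<And>x. x \<in> \<Omega> \<Longrightarrow> c \<le> \<Psi>p x"
    and init: "\<And>x. x \<in> \<Omega> \<Longrightarrow> P0 < (norm (x - z0))\<^sup>2"
    and final: "\<And>x. x \<in> S \<Longrightarrow> P1 < (norm (x - z1))\<^sup>2"
    and side: "\<And>x t. x \<in> \<Omega> \<Longrightarrow> x \<notin> interior \<Omega> \<Longrightarrow> x \<notin> S \<Longrightarrow> 0 \<le> t \<Longrightarrow> c \<le> u (x, t)"
    and x1: "x1 \<in> \<Omega>" "(norm (x1 - z1))\<^sup>2 < P1"
  shows "\<exists>\<tau>>0. \<forall>t>\<tau>. c \<le> u (x1, t)"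
proof -
  define \<eta>0 where "\<eta>0 = (P1 - (inverse \<nu>)\<^sup>2) / 2"
  have \<eta>0: "0 < \<eta>0" "(inverse \<nu>)\<^sup>2 < P1 - \<eta>0" using P by (auto simp: \<eta>0_def field_simps)
  define r where "r = sqrt (P1 - \<eta>0)"
  have r: "1 < \<nu> * r" unfolding r_def by (rule disc_touch_radius_gt[OF \<nu> \<eta>0(2)])
  obtain C where C: "0 < C"
    "\<And>x. x \<in> \<Omega> \<Longrightarrow> \<bar>(P1 - (norm (x - z1))\<^sup>2) - (P0 - (norm (x - z0))\<^sup>2)\<bar> \<le> C"
  proof (rule compact_abs_bound[of \<Omega> "\<lambda>x. (P1 - (norm (x - z1))\<^sup>2) - (P0 - (norm (x - z0))\<^sup>2)"])
    show "continuous_on \<Omega> (\<lambda>x. (P1 - (norm (x - z1))\<^sup>2) - (P0 - (norm (x - z0))\<^sup>2))"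
      by (intro continuous_intros)
  qed (use comp in auto)
  \<comment> \<open>The drift uses up half of the margin left by the motion of the circles.\<close>
  define \<epsilon> where "\<epsilon> = (\<nu> * r - 1) / C"
  have \<epsilon>: "0 < \<epsilon>" "\<epsilon> * C = \<nu> * r - 1" using C r by (auto simp: \<epsilon>_def)
  interpret drifting_pencil P0 P1 z0 z1 \<epsilon> .
  have slow: "speed x t + 2 - 2 * \<nu> * norm (x - centre t) \<le> 0"
    if x: "x \<in> \<Omega>" and t: "0 \<le> t" and "\<psi> x t < \<eta>0" for x t
  proof -
    have par: "0 \<le> par t" "par t < 1" using par_bounds[of t] \<epsilon> t by auto
    have "(1 - par t) * (P1 + (norm (z0 - z1))\<^sup>2) \<le> (1 - par t) * P0"
      using par P by (intro mult_left_mono) auto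
    moreover have "0 \<le> (1 - par t) * (1 - par t) * (norm (z0 - z1))\<^sup>2" using par by simp
    ultimately have "P1 \<le> rad2 t" by (simp add: rad2_def algebra_simps)
    then have "P1 - \<eta>0 \<le> (norm (x - centre t))\<^sup>2" using that by (simp add: \<psi>_circle)
    then have n: "r \<le> norm (x - centre t)" unfolding r_def by (rule real_le_lsqrt[rotated]) simp
    have "\<bar>speed x t\<bar> \<le> \<epsilon> * C" using C x \<epsilon> t by (intro abs_speed_le) auto
    moreover have "\<nu> * r \<le> \<nu> * norm (x - centre t)" using n \<nu> by simp
    ultimately show ?thesis using \<epsilon> r by (simp add: abs_le_iff)
  qed
  have "\<forall>\<^sub>F t in at_top. 0 < \<psi> x1 t"
    by (rule order_tendstoD(1)[OF \<psi>_tendsto]) (use \<epsilon> x1 in auto)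
  then obtain \<tau> where \<tau>: "\<And>t. \<tau> \<le> t \<Longrightarrow> 0 < \<psi> x1 t" unfolding eventually_at_top_linorder by blast
  have "c \<le> u (x1, t)" if "max \<tau> 1 < t" for t
    using that \<tau>[of t]
    by (intro lower_bound_inside_disc[OF \<epsilon>(1) super cont _ comp \<eta>0(1) slow upper init final side x1(1)]) auto
  then show ?thesis by (intro exI[of _ "max \<tau> 1"]) auto
qed

section \<open>Circles adapted to the hull\<close>

text \<open>
  Walk along the pencil from the disc about \<open>z\<close> towards the disc of radius \<open>m\<close> about \<open>y\<close> and stop just
  before the end: \<open>x\<close> is already excluded, the radius is still less than \<open>m\<close>, and the common part of
  the two discs lies inside every intermediate one.
\<close>

lemma exists_disc_between:
  fixes x y z :: "real^2"
  assumes "P0 < m\<^sup>2" "m\<^sup>2 < (norm (x - y))\<^sup>2"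
  obtains z1 P1 where "P1 < m\<^sup>2" "P1 < (norm (x - z1))\<^sup>2"
    "\<And>w. (norm (w - z))\<^sup>2 < P0 \<Longrightarrow> (norm (w - y))\<^sup>2 \<le> m\<^sup>2 \<Longrightarrow> (norm (w - z1))\<^sup>2 < P1"
proof -
  have "((\<lambda>\<theta>. (1 - \<theta>) * (P0 - (norm (x - z))\<^sup>2) + \<theta> * (m\<^sup>2 - (norm (x - y))\<^sup>2))
      \<longlongrightarrow> (1 - 1) * (P0 - (norm (x - z))\<^sup>2) + 1 * (m\<^sup>2 - (norm (x - y))\<^sup>2)) (at_left 1)"
    by (intro tendsto_intros)
  then have "\<forall>\<^sub>F \<theta> in at_left 1. (1 - \<theta>) * (P0 - (norm (x - z))\<^sup>2) + \<theta> * (m\<^sup>2 - (norm (x - y))\<^sup>2) < 0"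
    by (rule order_tendstoD) (use assms in simp)
  moreover have "\<forall>\<^sub>F \<theta> in at_left 1. \<theta> \<in> {0<..<1::real}"
    by (rule eventually_at_left_real) simp
  ultimately have "\<forall>\<^sub>F \<theta> in at_left 1. \<theta> \<in> {0<..<1::real} \<and>
      (1 - \<theta>) * (P0 - (norm (x - z))\<^sup>2) + \<theta> * (m\<^sup>2 - (norm (x - y))\<^sup>2) < 0"
    by eventually_elim simp
  from eventually_happens'[OF _ this] obtain \<theta> :: real where \<theta>: "0 < \<theta>" "\<theta> < 1"
    "(1 - \<theta>) * (P0 - (norm (x - z))\<^sup>2) + \<theta> * (m\<^sup>2 - (norm (x - y))\<^sup>2) < 0"
    by auto
  define z1 where "z1 = (1 - \<theta>) *\<^sub>R z + \<theta> *\<^sub>R y"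
  define P1 where "P1 = (1 - \<theta>) * P0 + \<theta> * m\<^sup>2 - \<theta> * (1 - \<theta>) * (norm (z - y))\<^sup>2"
  have pencil: "P1 - (norm (w - z1))\<^sup>2
      = (1 - \<theta>) * (P0 - (norm (w - z))\<^sup>2) + \<theta> * (m\<^sup>2 - (norm (w - y))\<^sup>2)" for w
    unfolding P1_def z1_def power2_norm_eq_inner
    by (simp add: inner_simps inner_commute algebra_simps power2_eq_square)
  show ?thesis
  proof (rule that[of P1 z1])
    have "(1 - \<theta>) * P0 < (1 - \<theta>) * m\<^sup>2" using assms \<theta> by (intro mult_strict_left_mono) auto
    moreover have "0 \<le> \<theta> * (1 - \<theta>) * (norm (z - y))\<^sup>2" using \<theta> by simp
    ultimately show "P1 < m\<^sup>2" by (simp add: P1_def algebra_simps)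
    show "P1 < (norm (x - z1))\<^sup>2" using \<theta>(3) pencil[of x] by linarith
    fix w assume w: "(norm (w - z))\<^sup>2 < P0" "(norm (w - y))\<^sup>2 \<le> m\<^sup>2"
    have "0 < (1 - \<theta>) * (P0 - (norm (w - z))\<^sup>2) + \<theta> * (m\<^sup>2 - (norm (w - y))\<^sup>2)"
      using w \<theta> by (intro add_pos_nonneg mult_pos_pos mult_nonneg_nonneg) auto
    then show "(norm (w - z1))\<^sup>2 < P1" using pencil[of w] by linarith
  qed
qed

lemma negative_bound_on_closed:
  fixes f :: "'a::euclidean_space \<Rightarrow> real"
  assumes "continuous_on UNIV f" "closed F" "\<And>w. w \<in> F \<Longrightarrow> f w < 0"
    and "a < 0" "\<And>w. \<rho> \<le> norm w \<Longrightarrow> f w \<le> a"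
  obtains c where "a \<le> c" "c < 0" "\<And>w. w \<in> F \<Longrightarrow> f w \<le> c"
proof -
  have "compact (F \<inter> cball 0 \<rho>)" using assms(2) by (rule closed_Int_compact) simp
  moreover have "continuous_on (F \<inter> cball 0 \<rho>) (\<lambda>w. - f w)"
    using assms(1) by (intro continuous_on_minus) (rule continuous_on_subset, auto)
  ultimately obtain \<eta> where \<eta>: "0 < \<eta>" "\<And>w. w \<in> F \<inter> cball 0 \<rho> \<Longrightarrow> \<eta> \<le> - f w"
    by (rule compact_uniformly_pos) (use assms(3) in auto)
  show ?thesis
  proof (rule that[of "max a (- \<eta>)"])
    fix w assume "w \<in> F"
    then show "f w \<le> max a (- \<eta>)"
      using assms(5)[of w] \<eta>(2)[of w] by (cases "\<rho> \<le> norm w") (force simp: max_def)+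
  qed (use \<eta> assms(4) in auto)
qed

lemma norm_sq_2: "(norm (x :: real^2))\<^sup>2 = (x $ 1)\<^sup>2 + (x $ 2)\<^sup>2"
  unfolding power2_norm_eq_inner inner_vec_def sum_2 by (simp add: power2_eq_square)

lemma notched_ball_subset_ball: "notched_ball r \<subseteq> ball 0 r"
  by (auto simp: notched_ball_def)

lemma interior_ball_hull_subset:
  fixes S :: "(real^2) set"
  assumes "S \<subseteq> cball y m"
  shows "interior (ball_hull m S) \<subseteq> ball y m"
proof -
  have "ball_hull m S \<subseteq> cball y m" using assms unfolding ball_hull_def by blast
  then have "interior (ball_hull m S) \<subseteq> interior (cball y m)" by (rule interior_mono)
  then show ?thesis by simp
qed

text \<open>
  For a point \<open>x\<close> with \<open>|x| \<ge> r\<close>, take the disc of radius \<open>m\<close> that encloses the disc of radius \<open>r\<close> and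
  touches its boundary in the direction of \<open>x\<close>: it contains \<open>S\<close>, and \<open>x\<close> is not in its interior.
\<close>

lemma interior_ball_hull_subset_ball:
  fixes S :: "(real^2) set"
  assumes "S \<subseteq> ball 0 r" "0 < r" "r \<le> m"
  shows "interior (ball_hull m S) \<subseteq> ball 0 r"
proof
  fix x assume x: "x \<in> interior (ball_hull m S)"
  show "x \<in> ball 0 r"
  proof (rule ccontr)
    assume "x \<notin> ball 0 r"
    then have rx: "r \<le> norm x" "0 < norm x" using assms by auto
    define y where "y = - ((m - r) / norm x) *\<^sub>R x"
    have ny: "norm y = m - r" using rx assms by (simp add: y_def)
    have "S \<subseteq> cball y m"
    proof
      fix w assume "w \<in> S"
      then have "norm w < r" using assms by auto
      then show "w \<in> cball y m" using norm_triangle_ineq4[of y w] ny by (simp add: dist_norm)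
    qed
    then have "dist y x < m" using interior_ball_hull_subset x by (metis mem_ball subsetD)
    moreover have "norm (x - y) = norm x + (m - r)"
    proof -
      have "x - y = (1 + (m - r) / norm x) *\<^sub>R x" by (simp add: y_def algebra_simps)
      moreover have "0 \<le> (m - r) / norm x" using assms by simp
      ultimately have "norm (x - y) = (1 + (m - r) / norm x) * norm x" by simp
      then show ?thesis using rx by (simp add: distrib_right)
    qed
    ultimately show False using rx by (simp add: dist_norm norm_minus_commute)
  qed
qed

text \<open>
  The corners of the notch are \<open>(\<plusminus>a, a)\<close> with \<open>a = r0/\<surd>2\<close>, and \<open>v b = (0, -b)\<close> is the centre of the
  circle of radius \<open>m\<close> through them. Lowering the centre slightly to \<open>v b1\<close> leaves room for a radius
  greater than \<open>m\<close>: the point \<open>x\<close> remains inside, while the corners become strictly exterior.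
  The region \<open>\<Omega>\<close> is a sector slightly larger than the notch but cut off at a radius \<open>r\<close> slightly smaller
  than \<open>r0\<close>, so that its straight sides \<open>K\<close> are inside the notched ball; \<open>S\<close> is its circular edge.
  The first disc has its top at height \<open>-b1/2\<close>, below \<open>\<Omega>\<close>. Its squared radius exceeds the squared
  distance of the two centres by \<open>b1 B - 3/4 b1\<^sup>2\<close>, which is at least \<open>P1\<close> if its centre is far enough down.
\<close>

lemma notch_filling_discs:
  fixes x :: "real^2"
  assumes r0: "0 < r0" "r0 < m"
    and x: "x \<in> interior (ball_hull m (notched_ball r0))" "x \<notin> notched_ball r0"
  obtains P0 P1 and z0 z1 :: "real^2" and \<Omega> S K where
    "compact \<Omega>" "compact S" "S \<subseteq> \<Omega>" "compact K" "K \<subseteq> notched_ball r0" "\<Omega> - interior \<Omega> \<subseteq> S \<union> K"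
    "m\<^sup>2 < P1" "P1 + (norm (z0 - z1))\<^sup>2 \<le> P0"
    "\<And>w. w \<in> \<Omega> \<Longrightarrow> P0 < (norm (w - z0))\<^sup>2" "\<And>w. w \<in> S \<Longrightarrow> P1 < (norm (w - z1))\<^sup>2"
    "x \<in> \<Omega>" "(norm (x - z1))\<^sup>2 < P1"
proof -
  define v where "v = (\<lambda>b::real. vector [0, - b] :: real^2)"
  have dv: "(norm (w - v b))\<^sup>2 = (norm w)\<^sup>2 + 2 * b * w $ 2 + b\<^sup>2" for w b
    unfolding norm_sq_2 by (simp add: v_def vector_2 power2_eq_square algebra_simps)
  define a where "a = r0 / sqrt 2"
  have a: "0 < a" "a\<^sup>2 = r0\<^sup>2 / 2" using r0 by (auto simp: a_def power_divide)
  have m2: "r0\<^sup>2 < m\<^sup>2" using r0 by (intro power_strict_mono) auto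
  define b where "b = sqrt (m\<^sup>2 - a\<^sup>2) - a"
  have b: "0 < b" "b\<^sup>2 + 2 * a * b + r0\<^sup>2 = m\<^sup>2"
  proof -
    have "a < sqrt (m\<^sup>2 - a\<^sup>2)" using a m2 by (intro real_less_rsqrt) simp
    then show "0 < b" by (simp add: b_def)
    have "0 \<le> m\<^sup>2 - a\<^sup>2" using a m2 zero_le_power2[of a] by linarith
    then have "(b + a)\<^sup>2 = m\<^sup>2 - a\<^sup>2" by (simp add: b_def)
    then show "b\<^sup>2 + 2 * a * b + r0\<^sup>2 = m\<^sup>2" using a by (simp add: power2_eq_square algebra_simps)
  qed
  have "notched_ball r0 \<subseteq> cball (v b) m"
  proof
    fix w assume w: "w \<in> notched_ball r0"
    then have nw: "norm w < r0" "w $ 2 < \<bar>w $ 1\<bar>" by (auto simp: notched_ball_def)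
    have nw2: "(norm w)\<^sup>2 < r0\<^sup>2" using nw by (intro power_strict_mono) auto
    have "w $ 2 \<le> a"
    proof (rule ccontr)
      assume "\<not> w $ 2 \<le> a"
      then have "a\<^sup>2 < (w $ 2)\<^sup>2" "a\<^sup>2 < \<bar>w $ 1\<bar>\<^sup>2"
        using a nw by (intro power_strict_mono; simp)+
      then show False using nw2 a by (simp add: norm_sq_2)
    qed
    then have "2 * b * w $ 2 \<le> 2 * a * b" using b by simp
    then have "(norm (w - v b))\<^sup>2 \<le> m\<^sup>2" using nw2 b(2) unfolding dv by linarith
    then have "norm (w - v b) \<le> m" by (rule power2_le_imp_le) (use r0 in auto)
    then show "w \<in> cball (v b) m" by (simp add: dist_norm norm_minus_commute)
  qed
  then have xb: "norm (x - v b) < m"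
    using interior_ball_hull_subset x(1) by (metis mem_ball dist_norm norm_minus_commute subsetD)
  have xr: "norm x < r0"
    using interior_ball_hull_subset_ball[OF notched_ball_subset_ball, of r0 m] r0 x(1) by auto
  have xn: "\<bar>x $ 1\<bar> \<le> x $ 2" using x(2) xr by (auto simp: notched_ball_def)
  \<comment> \<open>Half of the distance between \<open>x\<close> and the limiting arc is given away to the new centre.\<close>
  define b1 where "b1 = b + (m - norm (x - v b)) / 2"
  have "b < b1" using xb by (simp add: b1_def)
  then have b1: "b < b1" "0 < b1" using b(1) by linarith+
  have xb1: "norm (x - v b1) < m"
  proof -
    have "x - v b1 = (x - v b) + vector [0, b1 - b]"
      by (simp add: v_def vec_eq_iff forall_2 vector_2)
    then have "norm (x - v b1) \<le> norm (x - v b) + norm (vector [0, b1 - b] :: real^2)"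
      using norm_triangle_ineq by metis
    moreover have "(norm (vector [0, b1 - b] :: real^2))\<^sup>2 = (b1 - b)\<^sup>2"
      unfolding norm_sq_2 by (simp add: vector_2)
    then have "norm (vector [0, b1 - b] :: real^2) = b1 - b"
      using b1 by (simp add: power2_eq_iff_nonneg)
    moreover have "norm (x - v b) + (b1 - b) < m" using xb by (simp add: b1_def field_simps)
    ultimately show ?thesis by linarith
  qed
  \<comment> \<open>The squared distance of the corners of the notch from \<open>v b1\<close>.\<close>
  define L where "L = r0\<^sup>2 + 2 * b1 * a + b1\<^sup>2"
  have "m\<^sup>2 < L"
  proof -
    have "b\<^sup>2 < b1\<^sup>2" using b b1 by (intro power_strict_mono) auto
    moreover have "a * b < a * b1" using a b1 by simp
    ultimately show ?thesis using b(2) by (simp add: L_def mult_ac)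
  qed
  define P1 where "P1 = (m\<^sup>2 + L) / 2"
  have P1: "m\<^sup>2 < P1" "P1 < L" using \<open>m\<^sup>2 < L\<close> by (auto simp: P1_def)
  have "((\<lambda>e. (r0 - e)\<^sup>2 + 2 * b1 * ((r0 - e) / sqrt 2 - e) + b1\<^sup>2)
      \<longlongrightarrow> (r0 - 0)\<^sup>2 + 2 * b1 * ((r0 - 0) / sqrt 2 - 0) + b1\<^sup>2) (at_right 0)"
    by (intro tendsto_intros) simp
  then have "\<forall>\<^sub>F e in at_right 0. P1 < (r0 - e)\<^sup>2 + 2 * b1 * ((r0 - e) / sqrt 2 - e) + b1\<^sup>2"
    by (rule order_tendstoD) (use P1 in \<open>simp add: L_def a_def\<close>)
  moreover have "\<forall>\<^sub>F e in at_right 0. e \<in> {0<..<min (r0 - norm x) (min (b1 / 2) (r0 / 4))}"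
    by (rule eventually_at_right_real) (use xr b1 r0 in auto)
  ultimately have "\<forall>\<^sub>F e in at_right 0. P1 < (r0 - e)\<^sup>2 + 2 * b1 * ((r0 - e) / sqrt 2 - e) + b1\<^sup>2
      \<and> e \<in> {0<..<min (r0 - norm x) (min (b1 / 2) (r0 / 4))}"
    by eventually_elim simp
  from eventually_happens'[OF _ this] obtain e where
    e: "P1 < (r0 - e)\<^sup>2 + 2 * b1 * ((r0 - e) / sqrt 2 - e) + b1\<^sup>2"
      "0 < e" "e < r0 - norm x" "e < b1 / 2" "e < r0 / 4"
    by auto
  define r where "r = r0 - e"
  have r: "0 < r" "r < r0" "norm x \<le> r" using e by (auto simp: r_def)
  \<comment> \<open>The height of the corners after shrinking the ball; \<open>e < h\<close> keeps \<open>S\<close> above the height \<open>-h\<close>.\<close>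
  define h where "h = r / sqrt 2"
  have h: "0 < h" "2 * h\<^sup>2 = r\<^sup>2" "e < h"
  proof -
    show "0 < h" using r by (simp add: h_def)
    show h2: "2 * h\<^sup>2 = r\<^sup>2" by (simp add: h_def power_divide)
    have "(2 * e)\<^sup>2 < r\<^sup>2" using e by (intro power_strict_mono) (auto simp: r_def)
    then have "4 * e\<^sup>2 < r\<^sup>2" by (simp add: power_mult_distrib)
    then have "e\<^sup>2 < h\<^sup>2" using h2 zero_le_power2[of e] by linarith
    then show "e < h" by (rule power2_less_imp_less) (use \<open>0 < h\<close> in simp)
  qed
  define \<Omega> where "\<Omega> = cball 0 r \<inter> {w :: real^2. \<bar>w $ 1\<bar> - e \<le> w $ 2}"
  define S where "S = sphere 0 r \<inter> {w :: real^2. \<bar>w $ 1\<bar> - e \<le> w $ 2}"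
  define K where "K = cball 0 r \<inter> {w :: real^2. w $ 2 = \<bar>w $ 1\<bar> - e}"
  \<comment> \<open>The solution of \<open>b1 B = P1 + b1\<^sup>2\<close>.\<close>
  define B where "B = P1 / b1 + b1"
  have "0 < P1" using P1 m2 zero_le_power2[of r0] by linarith
  then have B: "b1 < B" "b1 * B = P1 + b1\<^sup>2" using b1 by (auto simp: B_def field_simps power2_eq_square)
  define P0 where "P0 = (B - b1 / 2)\<^sup>2"
  show ?thesis
  proof (rule that[of \<Omega> S K P1 "v B" "v b1" P0])
    have cl: "closed {w :: real^2. \<bar>w $ 1\<bar> - e \<le> w $ 2}"
      by (intro closed_Collect_le continuous_intros)
    show "compact \<Omega>" unfolding \<Omega>_def using cl by (intro compact_Int_closed) auto
    show "compact S" unfolding S_def using cl by (intro compact_Int_closed) auto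
    have "closed {w :: real^2. w $ 2 = \<bar>w $ 1\<bar> - e}"
      by (intro closed_Collect_eq continuous_intros)
    then show "compact K" unfolding K_def by (intro compact_Int_closed) auto
    show "S \<subseteq> \<Omega>" by (auto simp: S_def \<Omega>_def)
    show "K \<subseteq> notched_ball r0" using r e by (auto simp: K_def notched_ball_def)
    show "\<Omega> - interior \<Omega> \<subseteq> S \<union> K"
    proof -
      have "open (ball 0 r \<inter> {w :: real^2. \<bar>w $ 1\<bar> - e < w $ 2})"
        by (intro open_Int open_Collect_less continuous_intros) auto
      then have "ball 0 r \<inter> {w :: real^2. \<bar>w $ 1\<bar> - e < w $ 2} \<subseteq> interior \<Omega>"
        by (intro interior_maximal) (auto simp: \<Omega>_def)
      then show ?thesis by (force simp: \<Omega>_def S_def K_def)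
    qed
    show "m\<^sup>2 < P1" by (rule P1)
    have "(norm (v B - v b1))\<^sup>2 = (B - b1)\<^sup>2"
      unfolding norm_sq_2 by (simp add: v_def vector_2 power2_eq_square algebra_simps)
    moreover have "P0 = (B - b1)\<^sup>2 + b1 * B - 3 / 4 * b1\<^sup>2"
      by (simp add: P0_def power2_eq_square field_simps)
    ultimately show "P1 + (norm (v B - v b1))\<^sup>2 \<le> P0"
      using B(2) zero_le_power2[of b1] by linarith
    show "P0 < (norm (w - v B))\<^sup>2" if "w \<in> \<Omega>" for w
    proof -
      have "\<bar>w $ 1\<bar> - e \<le> w $ 2" using that by (simp add: \<Omega>_def)
      then have "- e \<le> w $ 2" using abs_ge_zero[of "w $ 1"] by linarith
      then have "P0 < (w $ 2 + B)\<^sup>2" unfolding P0_def using e B b1 by (intro power_strict_mono) auto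
      also have "\<dots> \<le> (norm (w - v B))\<^sup>2" unfolding norm_sq_2 by (simp add: v_def vector_2)
      finally show ?thesis .
    qed
    show "P1 < (norm (w - v b1))\<^sup>2" if "w \<in> S" for w
    proof -
      have w: "(w $ 1)\<^sup>2 + (w $ 2)\<^sup>2 = r\<^sup>2" "(norm w)\<^sup>2 = r\<^sup>2" "\<bar>w $ 1\<bar> \<le> w $ 2 + e"
        using that norm_sq_2[of w] by (auto simp: S_def)
      have "h - e \<le> w $ 2"
      proof (rule ccontr)
        assume "\<not> h - e \<le> w $ 2"
        then have "\<bar>w $ 1\<bar> < h" "\<bar>w $ 2\<bar> < h"
          using w(3) h(3) e(2) abs_ge_zero[of "w $ 1"] by linarith+
        then have "\<bar>w $ 1\<bar>\<^sup>2 < h\<^sup>2" "\<bar>w $ 2\<bar>\<^sup>2 < h\<^sup>2" by (intro power_strict_mono; simp)+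
        then show False using w(1) h(2) by simp
      qed
      then have "2 * b1 * (h - e) \<le> 2 * b1 * w $ 2" using b1 by simp
      then show ?thesis using e(1) w(2) unfolding dv h_def r_def by linarith
    qed
    show "x \<in> \<Omega>" using r xn e by (simp add: \<Omega>_def)
    have "(norm (x - v b1))\<^sup>2 < m\<^sup>2" using xb1 by (intro power_strict_mono) auto
    then show "(norm (x - v b1))\<^sup>2 < P1" using P1 by linarith
  qed
qed

section \<open>Limits of the evolutions\<close>

lemma liminf_sets_subset_limsup_sets: "liminf_sets D \<subseteq> limsup_sets D"
proof
  fix x assume "x \<in> liminf_sets D"
  then obtain \<tau> where \<tau>: "0 < \<tau>" "\<And>t. \<tau> < t \<Longrightarrow> x \<in> D t" unfolding liminf_sets_def by auto
  have "\<exists>t>s. x \<in> D t" for s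
    using \<tau>(2)[of "max \<tau> s + 1"] by (intro exI[of _ "max \<tau> s + 1"]) auto
  then show "x \<in> limsup_sets D" unfolding limsup_sets_def by auto
qed

lemma limsup_sets_subsetI:
  assumes "\<And>x. x \<notin> A \<Longrightarrow> \<exists>\<tau>>0. \<forall>t>\<tau>. x \<notin> D t"
  shows "limsup_sets D \<subseteq> A"
  using assms unfolding limsup_sets_def by blast

lemma liminf_sets_supsetI:
  assumes "\<And>x. x \<in> A \<Longrightarrow> \<exists>\<tau>>0. \<forall>t>\<tau>. x \<in> D t"
  shows "A \<subseteq> liminf_sets D"
  using assms unfolding liminf_sets_def by blast

lemma not_in_ball_hullE:
  assumes "x \<notin> ball_hull m S"
  obtains y where "S \<subseteq> cball y m" "m < dist y x"
  using assms unfolding ball_hull_def by force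

lemma obstacle_data_continuous: "obstacle_data \<Psi>m \<Psi>p u0 \<Longrightarrow> continuous_on UNIV \<Psi>m \<and> continuous_on UNIV \<Psi>p"
  unfolding obstacle_data_def by (auto dest: lipschitz_on_continuous_on)

lemma sq_dist_less: "w \<in> ball y r \<Longrightarrow> (norm (w - y))\<^sup>2 < r\<^sup>2"
  by (intro power_strict_mono) (auto simp: dist_norm norm_minus_commute)

lemma sq_dist_le: "w \<in> cball y r \<Longrightarrow> (norm (w - y))\<^sup>2 \<le> r\<^sup>2"
  by (intro power_mono) (auto simp: dist_norm norm_minus_commute)

lemma sq_dist_gr: "0 \<le> r \<Longrightarrow> r < dist y w \<Longrightarrow> r\<^sup>2 < (norm (w - y))\<^sup>2"
  by (intro power_strict_mono) (auto simp: dist_norm norm_minus_commute)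

text \<open>
  At level \<open>0\<close> it suffices that \<open>{u > 0}\<close> is initially inside the disc about \<open>z\<close>; the solution may
  vanish outside.
\<close>

lemma open_evolution_upper:
  fixes z :: "real^2"
  assumes \<nu>: "0 < \<nu>" and R: "R < inverse \<nu>" "D0 \<subseteq> ball z R" "Om \<noteq> {}"
    and ev: "open_evolution \<nu> D0 Om Op D"
  shows "limsup_sets D \<subseteq> ball_hull (inverse \<nu>) Om"
proof (rule limsup_sets_subsetI)
  fix x assume "x \<notin> ball_hull (inverse \<nu>) Om"
  then obtain y where y: "Om \<subseteq> cball y (inverse \<nu>)" "inverse \<nu> < dist y x"
    by (rule not_in_ball_hullE)
  obtain a \<Psi>m \<Psi>p u0 u where u: "a < 0" "obstacle_data \<Psi>m \<Psi>p u0"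
      "viscosity_solution \<nu> \<Psi>m \<Psi>p u0 u" "u \<in> K_class a" "Om = {x. \<Psi>m x > 0}"
      "\<And>t. t \<ge> 0 \<Longrightarrow> D t = {x. u (x, t) > 0}"
    using ev unfolding open_evolution_def by blast
  have D0: "D0 = {x. u (x, 0) > 0}" "Om \<subseteq> D0" using ev u(6)[of 0] unfolding open_evolution_def by auto
  have "0 < R" using D0(2) R by (metis ball_eq_empty not_le subset_empty subset_trans)
  then have "R\<^sup>2 < (inverse \<nu>)\<^sup>2" using R by (intro power_strict_mono) auto
  moreover have "(inverse \<nu>)\<^sup>2 < (norm (x - y))\<^sup>2" using y \<nu> by (intro sq_dist_gr) auto
  ultimately obtain z1 P1 where P1: "P1 < (inverse \<nu>)\<^sup>2" "P1 < (norm (x - z1))\<^sup>2"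
    "\<And>w. (norm (w - z))\<^sup>2 < R\<^sup>2 \<Longrightarrow> (norm (w - y))\<^sup>2 \<le> (inverse \<nu>)\<^sup>2 \<Longrightarrow> (norm (w - z1))\<^sup>2 < P1"
    by (rule exists_disc_between[where z = z]) blast
  have init: "(norm (w - z))\<^sup>2 < R\<^sup>2" if "0 < u (w, 0)" for w
    using that D0 R by (intro sq_dist_less) auto
  have obst: "(norm (w - z))\<^sup>2 < R\<^sup>2 \<and> (norm (w - z1))\<^sup>2 < P1" if "0 < \<Psi>m w" for w
  proof -
    have w: "w \<in> Om" using that u by simp
    then have "(norm (w - z))\<^sup>2 < R\<^sup>2" using D0 R by (intro sq_dist_less) auto
    moreover have "(norm (w - y))\<^sup>2 \<le> (inverse \<nu>)\<^sup>2" using w y by (intro sq_dist_le) auto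
    ultimately show ?thesis using P1(3) by blast
  qed
  have "\<exists>\<tau>>0. \<forall>t>\<tau>. u (x, t) \<le> 0"
    using u \<open>R\<^sup>2 < (inverse \<nu>)\<^sup>2\<close> obstacle_data_continuous[OF u(2)]
    by (intro eventually_below_outside_disc[OF \<nu> _ u(4) _ _ _ P1(1) init obst P1(2)])
       (auto simp: viscosity_solution_def)
  then obtain \<tau> where "0 < \<tau>" "\<And>t. \<tau> < t \<Longrightarrow> u (x, t) \<le> 0" by blast
  then show "\<exists>\<tau>>0. \<forall>t>\<tau>. x \<notin> D t"
    using u(6) by (intro exI[of _ \<tau>]) (auto simp: not_less)
qed

text \<open>
  Here \<open>u < 0\<close> has to be shown, so the comparison is made at a negative level \<open>c\<close>. Such a level exists:
  the initial value is negative outside a slightly enlarged first disc, the obstacle is negative outside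
  the first and outside the last disc, and far away both are at most \<open>a < 0\<close>.
\<close>

lemma closed_evolution_upper:
  fixes z :: "real^2"
  assumes \<nu>: "0 < \<nu>" and R: "R < inverse \<nu>" "D0 \<subseteq> ball z R" and Om: "Om \<noteq> {}" "Om \<subseteq> D0"
    and ev: "closed_evolution \<nu> (closure D0) (closure Om) Op E"
  shows "limsup_sets E \<subseteq> ball_hull (inverse \<nu>) Om"
proof (rule limsup_sets_subsetI)
  fix x assume "x \<notin> ball_hull (inverse \<nu>) Om"
  then obtain y where y: "Om \<subseteq> cball y (inverse \<nu>)" "inverse \<nu> < dist y x"
    by (rule not_in_ball_hullE)
  obtain a \<Psi>m \<Psi>p u0 u where u: "a < 0" "obstacle_data \<Psi>m \<Psi>p u0"
      "viscosity_solution \<nu> \<Psi>m \<Psi>p u0 u" "u \<in> K_class a" "closure Om = {x. \<Psi>m x \<ge> 0}"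
      "\<And>t. t \<ge> 0 \<Longrightarrow> E t = {x. u (x, t) \<ge> 0}"
    using ev unfolding closed_evolution_def by blast
  have E0: "closure D0 = {x. u (x, 0) \<ge> 0}" using ev u(6)[of 0] unfolding closed_evolution_def by auto
  have "0 < R" using Om R by (metis ball_eq_empty not_le subset_empty subset_trans)
  \<comment> \<open>Room between the closure of the initial set and the first circle.\<close>
  define R2 where "R2 = (R + inverse \<nu>) / 2"
  have R2: "0 < R2" "R < R2" "R2 < inverse \<nu>" using \<open>0 < R\<close> R by (auto simp: R2_def)
  have D0: "closure D0 \<subseteq> ball z R2"
  proof -
    have "closure D0 \<subseteq> cball z R" using R(2) by (intro closure_minimal) auto
    then show ?thesis using R2 by auto
  qed
  have Omy: "closure Om \<subseteq> cball y (inverse \<nu>)" using y by (intro closure_minimal) auto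
  have R2sq: "R2\<^sup>2 < (inverse \<nu>)\<^sup>2" using R2 by (intro power_strict_mono) auto
  moreover have "(inverse \<nu>)\<^sup>2 < (norm (x - y))\<^sup>2" using y \<nu> by (intro sq_dist_gr) auto
  ultimately obtain z1 P1 where P1: "P1 < (inverse \<nu>)\<^sup>2" "P1 < (norm (x - z1))\<^sup>2"
    "\<And>w. (norm (w - z))\<^sup>2 < R2\<^sup>2 \<Longrightarrow> (norm (w - y))\<^sup>2 \<le> (inverse \<nu>)\<^sup>2 \<Longrightarrow> (norm (w - z1))\<^sup>2 < P1"
    by (rule exists_disc_between[where z = z]) blast
  have cont: "continuous_on (UNIV \<times> {0..}) u" using u(4) by (simp add: K_class_def)
  obtain \<rho> where \<rho>: "\<And>w. \<rho> \<le> norm w \<Longrightarrow> u (w, 0) = a"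
  proof -
    have "\<forall>T>0. \<exists>R>0. \<forall>x t. R \<le> norm x \<and> 0 \<le> t \<and> t \<le> T \<longrightarrow> u (x, t) = a"
      using u(4) by (simp add: K_class_def)
    then obtain R where "\<forall>x t. R \<le> norm x \<and> 0 \<le> t \<and> t \<le> 1 \<longrightarrow> u (x, t) = a"
      using zero_less_one by blast
    then show ?thesis by (intro that[of R]) auto
  qed
  obtain c1 where c1: "a \<le> c1" "c1 < 0" "\<And>w. w \<in> - ball z R2 \<Longrightarrow> u (w, 0) \<le> c1"
  proof (rule negative_bound_on_closed[of "\<lambda>w. u (w, 0)" "- ball z R2" a \<rho>])
    show "continuous_on UNIV (\<lambda>w. u (w, 0))"
      by (rule continuous_on_compose2[OF cont]) (auto intro!: continuous_intros)
    show "closed (- ball z R2)" by (simp add: closed_Compl)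
    show "u (w, 0) < 0" if "w \<in> - ball z R2" for w
    proof -
      have "w \<notin> {x. u (x, 0) \<ge> 0}" using that D0 E0 by blast
      then show ?thesis by simp
    qed
    show "u (w, 0) \<le> a" if "\<rho> \<le> norm w" for w using \<rho>[OF that] by simp
  qed (use u(1) that in blast)+
  obtain c2 where c2: "a \<le> c2" "c2 < 0"
    "\<And>w. w \<in> - ball z R2 \<union> {w. P1 \<le> (norm (w - z1))\<^sup>2} \<Longrightarrow> \<Psi>m w \<le> c2"
  proof (rule negative_bound_on_closed[of \<Psi>m "- ball z R2 \<union> {w. P1 \<le> (norm (w - z1))\<^sup>2}" a \<rho>])
    show "continuous_on UNIV \<Psi>m" using obstacle_data_continuous[OF u(2)] by blast
    show "closed (- ball z R2 \<union> {w. P1 \<le> (norm (w - z1))\<^sup>2})"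
      by (intro closed_Un closed_Collect_le continuous_intros) auto
    show "\<Psi>m w < 0" if "w \<in> - ball z R2 \<union> {w. P1 \<le> (norm (w - z1))\<^sup>2}" for w
    proof (rule ccontr)
      assume "\<not> \<Psi>m w < 0"
      then have w: "w \<in> closure Om" using u(5) by simp
      then have "w \<in> ball z R2" using D0 closure_mono[OF Om(2)] by blast
      moreover have "(norm (w - z1))\<^sup>2 < P1"
        using calculation w Omy by (intro P1(3) sq_dist_less sq_dist_le) auto
      ultimately show False using that by auto
    qed
    show "\<Psi>m w \<le> a" if "\<rho> \<le> norm w" for w
      using solution_obstacle[OF u(3) cont, of 0 w] \<rho>[OF that] by simp
  qed (use u(1) that in blast)+
  define c where "c = max c1 c2"
  have c: "a \<le> c" "c < 0" using c1 c2 by (auto simp: c_def)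
  have init: "(norm (w - z))\<^sup>2 < R2\<^sup>2" if "c < u (w, 0)" for w
  proof (rule sq_dist_less, rule ccontr)
    assume "w \<notin> ball z R2"
    then have "u (w, 0) \<le> c1" using c1(3) by blast
    then show False using that unfolding c_def by linarith
  qed
  have obst: "(norm (w - z))\<^sup>2 < R2\<^sup>2 \<and> (norm (w - z1))\<^sup>2 < P1" if "c < \<Psi>m w" for w
  proof -
    have w: "\<not> (w \<in> - ball z R2 \<union> {w. P1 \<le> (norm (w - z1))\<^sup>2})"
      using that c2(3)[of w] unfolding c_def by linarith
    then have "w \<in> ball z R2" by blast
    then show ?thesis using w sq_dist_less by auto
  qed
  have "\<exists>\<tau>>0. \<forall>t>\<tau>. u (x, t) \<le> c"
    using u c R2sq obstacle_data_continuous[OF u(2)]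
    by (intro eventually_below_outside_disc[OF \<nu> _ u(4) _ _ _ P1(1) init obst P1(2)])
       (auto simp: viscosity_solution_def)
  then obtain \<tau> where \<tau>: "0 < \<tau>" "\<And>t. \<tau> < t \<Longrightarrow> u (x, t) \<le> c" by blast
  have "x \<notin> E t" if "\<tau> < t" for t
    using \<tau>(2)[OF that] \<tau>(1) that c u(6)[of t] by simp
  then show "\<exists>\<tau>>0. \<forall>t>\<tau>. x \<notin> E t" using \<tau>(1) by blast
qed

text \<open>
  The parameter \<open>good\<close> lets the open and the closed evolution share this argument: the level must be
  positive for the former and \<open>0\<close> for the latter.
\<close>

lemma eventually_above_in_notch:
  fixes x :: "real^2"
  assumes \<nu>: "0 < \<nu>" and r0: "0 < r0" "r0 < inverse \<nu>"
    and x: "x \<in> interior (ball_hull (inverse \<nu>) (notched_ball r0))" "x \<notin> notched_ball r0"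
    and sol: "viscosity_solution \<nu> \<Psi>m \<Psi>p u0 u" and cont: "continuous_on (UNIV \<times> {0..}) u"
    and level: "\<And>K \<Omega>. compact K \<Longrightarrow> K \<subseteq> notched_ball r0 \<Longrightarrow> compact \<Omega> \<Longrightarrow>
        \<exists>c. good c \<and> (\<forall>w\<in>K. c \<le> \<Psi>m w) \<and> (\<forall>w\<in>\<Omega>. c \<le> \<Psi>p w)"
  shows "\<exists>c \<tau>. good c \<and> \<tau> > 0 \<and> (\<forall>t>\<tau>. c \<le> u (x, t))"
proof -
  obtain P0 P1 and z0 z1 :: "real^2" and \<Omega> S K where g:
    "compact \<Omega>" "compact S" "S \<subseteq> \<Omega>" "compact K" "K \<subseteq> notched_ball r0" "\<Omega> - interior \<Omega> \<subseteq> S \<union> K"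
    "(inverse \<nu>)\<^sup>2 < P1" "P1 + (norm (z0 - z1))\<^sup>2 \<le> P0"
    "\<And>w. w \<in> \<Omega> \<Longrightarrow> P0 < (norm (w - z0))\<^sup>2" "\<And>w. w \<in> S \<Longrightarrow> P1 < (norm (w - z1))\<^sup>2"
    "x \<in> \<Omega>" "(norm (x - z1))\<^sup>2 < P1"
    using notch_filling_discs[OF r0 x] by metis
  obtain c where c: "good c" "\<And>w. w \<in> K \<Longrightarrow> c \<le> \<Psi>m w" "\<And>w. w \<in> \<Omega> \<Longrightarrow> c \<le> \<Psi>p w"
    using level[OF g(4,5,1)] by blast
  have side: "c \<le> u (w, t)" if "w \<in> \<Omega>" "w \<notin> interior \<Omega>" "w \<notin> S" "0 \<le> t" for w t
  proof -
    have "w \<in> K" using that g(6) by blast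
    then show ?thesis using c(2) solution_obstacle[OF sol cont that(4), of w] by force
  qed
  have "\<exists>\<tau>>0. \<forall>t>\<tau>. c \<le> u (x, t)"
    using sol by (intro eventually_above_inside_disc[OF \<nu> _ cont g(1-3,7,8) c(3) g(9,10) side g(11,12)])
      (auto simp: viscosity_solution_def)
  then show ?thesis using c(1) by blast
qed

lemma open_evolution_lower:
  assumes \<nu>: "0 < \<nu>" and r0: "0 < r0" "r0 < inverse \<nu>"
    and ev: "open_evolution \<nu> D0 (notched_ball r0) UNIV D"
  shows "interior (ball_hull (inverse \<nu>) (notched_ball r0)) \<subseteq> liminf_sets D"
proof (rule liminf_sets_supsetI)
  fix x assume x: "x \<in> interior (ball_hull (inverse \<nu>) (notched_ball r0))"
  obtain a \<Psi>m \<Psi>p u0 u where u: "obstacle_data \<Psi>m \<Psi>p u0"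
      "viscosity_solution \<nu> \<Psi>m \<Psi>p u0 u" "u \<in> K_class a" "notched_ball r0 = {x. \<Psi>m x > 0}"
      "UNIV = {x. \<Psi>p x > 0}" "\<And>t. t \<ge> 0 \<Longrightarrow> D t = {x. u (x, t) > 0}"
    using ev unfolding open_evolution_def by blast
  have cont: "continuous_on (UNIV \<times> {0..}) u" using u(3) by (simp add: K_class_def)
  note co = obstacle_data_continuous[OF u(1)]
  show "\<exists>\<tau>>0. \<forall>t>\<tau>. x \<in> D t"
  proof (cases "x \<in> notched_ball r0")
    case True
    have "notched_ball r0 \<subseteq> D t" if "0 \<le> t" for t
      using ev that unfolding open_evolution_def by blast
    then have "x \<in> D t" if "1 < t" for t using True that less_imp_le[of 0 t] by fastforce
    then show ?thesis using zero_less_one by blast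
  next
    case False
    have "\<exists>c \<tau>. 0 < c \<and> \<tau> > 0 \<and> (\<forall>t>\<tau>. c \<le> u (x, t))"
    proof (rule eventually_above_in_notch[OF \<nu> r0 x False u(2) cont])
      fix K \<Omega> :: "(real^2) set" assume K: "compact K" "K \<subseteq> notched_ball r0" and \<Omega>: "compact \<Omega>"
      have contK: "continuous_on K \<Psi>m" and cont\<Omega>: "continuous_on \<Omega> \<Psi>p"
        using co continuous_on_subset by blast+
      have posK: "0 < \<Psi>m w" if "w \<in> K" for w using that K(2) u(4) by blast
      have pos\<Omega>: "0 < \<Psi>p w" for w using u(5) by blast
      obtain c1 where c1: "0 < c1" "\<And>w. w \<in> K \<Longrightarrow> c1 \<le> \<Psi>m w"
        using compact_uniformly_pos[OF K(1) contK posK] by blast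
      obtain c2 where c2: "0 < c2" "\<And>w. w \<in> \<Omega> \<Longrightarrow> c2 \<le> \<Psi>p w"
        using compact_uniformly_pos[OF \<Omega> cont\<Omega> pos\<Omega>] by blast
      show "\<exists>c. 0 < c \<and> (\<forall>w\<in>K. c \<le> \<Psi>m w) \<and> (\<forall>w\<in>\<Omega>. c \<le> \<Psi>p w)"
        using c1 c2 by (intro exI[of _ "min c1 c2"]) (auto simp: min_le_iff_disj)
    qed
    then obtain c \<tau> where c: "0 < c" "0 < \<tau>" "\<And>t. \<tau> < t \<Longrightarrow> c \<le> u (x, t)" by blast
    have "x \<in> D t" if "\<tau> < t" for t
    proof -
      have "0 < u (x, t)" using c(1) c(3)[OF that] by linarith
      then show ?thesis using u(6)[of t] c(2) that by simp
    qed
    then show ?thesis using c(2) by blast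
  qed
qed

text \<open>
  The level \<open>0\<close> itself can be used, since the barriers stay strictly below it and so never meet the
  upper obstacle \<open>\<Psi>p \<ge> 0\<close>.
\<close>

lemma closed_evolution_lower:
  assumes \<nu>: "0 < \<nu>" and r0: "0 < r0" "r0 < inverse \<nu>"
    and ev: "closed_evolution \<nu> E0 (closure (notched_ball r0)) UNIV E"
  shows "interior (ball_hull (inverse \<nu>) (notched_ball r0)) \<subseteq> liminf_sets E"
proof (rule liminf_sets_supsetI)
  fix x assume x: "x \<in> interior (ball_hull (inverse \<nu>) (notched_ball r0))"
  obtain a \<Psi>m \<Psi>p u0 u where u: "viscosity_solution \<nu> \<Psi>m \<Psi>p u0 u" "u \<in> K_class a"
      "closure (notched_ball r0) = {x. \<Psi>m x \<ge> 0}"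
      "UNIV = {x. \<Psi>p x \<ge> 0}" "\<And>t. t \<ge> 0 \<Longrightarrow> E t = {x. u (x, t) \<ge> 0}"
    using ev unfolding closed_evolution_def by blast
  have cont: "continuous_on (UNIV \<times> {0..}) u" using u(2) by (simp add: K_class_def)
  show "\<exists>\<tau>>0. \<forall>t>\<tau>. x \<in> E t"
  proof (cases "x \<in> notched_ball r0")
    case True
    have "closure (notched_ball r0) \<subseteq> E t" if "0 \<le> t" for t
      using ev that unfolding closed_evolution_def by blast
    then have "x \<in> E t" if "1 < t" for t
      using True that closure_subset[of "notched_ball r0"] less_imp_le[of 0 t] by fastforce
    then show ?thesis using zero_less_one by blast
  next
    case False
    have "\<exists>c \<tau>. c = 0 \<and> \<tau> > 0 \<and> (\<forall>t>\<tau>. c \<le> u (x, t))"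
    proof (rule eventually_above_in_notch[OF \<nu> r0 x False u(1) cont])
      fix K \<Omega> :: "(real^2) set" assume "K \<subseteq> notched_ball r0"
      then have "K \<subseteq> {x. \<Psi>m x \<ge> 0}" using u(3) closure_subset by blast
      then show "\<exists>c. c = 0 \<and> (\<forall>w\<in>K. c \<le> \<Psi>m w) \<and> (\<forall>w\<in>\<Omega>. c \<le> \<Psi>p w)"
        using u(4) by blast
    qed
    then obtain \<tau> where c: "0 < \<tau>" "\<And>t. \<tau> < t \<Longrightarrow> 0 \<le> u (x, t)" by blast
    have "x \<in> E t" if "\<tau> < t" for t using c(2)[OF that] c that u(5)[of t] by simp
    then show ?thesis using c(1) by blast
  qed
qed

lemma notched_ball_nonempty:
  assumes "0 < r" shows "notched_ball r \<noteq> {}"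
proof -
  have "vector [0, - (r / 2)] \<in> notched_ball r"
  proof -
    have "(norm (vector [0, - (r / 2)] :: real^2))\<^sup>2 < r\<^sup>2"
      unfolding norm_sq_2 using assms by (simp add: vector_2 power2_eq_square)
    then have "norm (vector [0, - (r / 2)] :: real^2) < r"
      using assms by (intro power2_less_imp_less[of _ r]) auto
    then show ?thesis using assms by (simp add: notched_ball_def vector_2)
  qed
  then show ?thesis by blast
qed

theorem proposition4p13:
  fixes \<nu> R' R :: real and z :: "real^2" and D0 :: "(real^2) set"
    and D E :: "real \<Rightarrow> (real^2) set"
  assumes "0 < \<nu>" and "0 < R'" and "R' < inverse \<nu>"
    and "open D0" and "notched_ball R' \<subseteq> D0"
    and "D0 \<subseteq> ball z R" and "R < inverse \<nu>"
    and "open_evolution \<nu> D0 (notched_ball R') UNIV D"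
    and "closed_evolution \<nu> (closure D0) (closure (notched_ball R')) UNIV E"
  shows "interior (ball_hull (inverse \<nu>) (notched_ball R')) \<subseteq> liminf_sets D
    \<and> liminf_sets D \<subseteq> limsup_sets D
    \<and> limsup_sets D \<subseteq> ball_hull (inverse \<nu>) (notched_ball R')
    \<and> interior (ball_hull (inverse \<nu>) (notched_ball R')) \<subseteq> liminf_sets E
    \<and> liminf_sets E \<subseteq> limsup_sets E
    \<and> limsup_sets E \<subseteq> ball_hull (inverse \<nu>) (notched_ball R')"
  using open_evolution_lower[OF assms(1-3,8)] closed_evolution_lower[OF assms(1-3,9)]
    open_evolution_upper[OF assms(1,7,6) notched_ball_nonempty[OF assms(2)] assms(8)]
    closed_evolution_upper[OF assms(1,7,6) notched_ball_nonempty[OF assms(2)] assms(5,9)]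
    liminf_sets_subset_limsup_sets[of D] liminf_sets_subset_limsup_sets[of E]
  by blast

end
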